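(* Let $p\in[1,\infty)$, $\delta\ge0$, and let $\Lambda:\mathbb R\to[0,1)$ be a decreasing function. For any $X\in L^p$, $$\sup\left\{\mathrm{EVaR}^p_\Lambda(Y):\ Y\in L^p,\ W_p(X,Y)\le\delta\right\}=\sup_{x\in\mathbb R}\min\left\{\mathrm{EVaR}^p_{\Lambda(x)}(X)+\delta(1-\Lambda(x))^{-1/p},\ x\right\}.$$
   Context: $(\Omega,\mathcal F,\mathbb P)$ is an atomless probability space, $L^p=L^p(\Omega,\mathcal F,\mathbb P)$, $\overline{\mathbb R}=[-\infty,\infty]$. "Increasing" and "decreasing" are meant in the weak (non-strict) sense. Let $p\in[1,\infty)$ and $q\in(1,\infty]$ with $1/p+1/q=1$. Rényi entropy: for a probability measure $\mathbb Q\ll\mathbb P$, $H_q(d\mathbb Q/d\mathbb P)=\frac1{q-1}\log\mathbb E[(d\mathbb Q/d\mathbb P)^q]$ if $q\in(1,\infty)$, and $H_\infty(d\mathbb Q/d\mathbb P)=\log\|d\mathbb Q/d\mathbb P\|_\infty$; $H_q=\infty$ if these are not finite or if $\mathbb Q\not\ll\mathbb P$. Rényi entropic value-at-risk: for $X\in L^p$ and $\alpha\in[0,1)$, $\mathrm{EVaR}^p_\alpha(X)=\sup\{\mathbb E_{\mathbb Q}[X]: H_q(d\mathbb Q/d\mathbb P)\le\log\frac1{1-\alpha}\}$; and $\mathrm{EVaR}^p_1(X)=\operatorname{ess\,sup}(X)$. Lambda version, for decreasing $\Lambda:\mathbb R\to[0,1]$: $\mathrm{EVaR}^p_\Lambda:L^p\to\overline{\mathbb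 R}$, $\mathrm{EVaR}^p_\Lambda(X)=\sup_{x\in\mathbb R}\min\{\mathrm{EVaR}^p_{\Lambda(x)}(X),x\}$. Wasserstein distance of order $k\in[1,\infty)$ between (the laws of) $X$ and $Y$: $W_k(X,Y)=\left(\int_0^1|F_X^{-1}(\alpha)-F_Y^{-1}(\alpha)|^k\,d\alpha\right)^{1/k}$, where $F_X^{-1},F_Y^{-1}$ are the quantile functions; equivalently the infimum of $\|X'-Y'\|_k$ over couplings with $X'\stackrel{d}{=}X$, $Y'\stackrel{d}{=}Y$. *)

theory Defs
  imports "HOL-Probability.Probability"
begin

definition atomless :: "'a measure \<Rightarrow> bool" where
  "atomless M \<longleftrightarrow> (\<forall>A\<in>sets M. 0 < emeasure M A \<longrightarrow>
     (\<exists>B\<in>sets M. B \<subseteq> A \<and> 0 < emeasure M B \<and> emeasure M B < emeasure M A))"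

text \<open>Elements of \<open>L\<^sup>p\<close> are represented by functions, not by classes modulo almost sure equality.\<close>

definition Lp :: "'a measure \<Rightarrow> real \<Rightarrow> ('a \<Rightarrow> real) set" where
  "Lp M p = {X \<in> borel_measurable M. integrable M (\<lambda>\<omega>. \<bar>X \<omega>\<bar> powr p)}"

definition conj_exponent :: "real \<Rightarrow> ereal" where
  "conj_exponent p = (if p = 1 then \<infinity> else ereal (p / (p - 1)))"

lemma conj_exponent_iff:
  assumes "1 \<le> p" "1 < q"
  shows "q = conj_exponent p \<longleftrightarrow> 1 / ereal p + 1 / q = 1"
proof (cases q)
  case (real r)
  with assms have r: "1 < r" and p: "0 < p" by simp_all
  have "1 / ereal p + 1 / q = 1 \<longleftrightarrow> 1 / p + 1 / r = 1"
    using r p real by (simp add: one_ereal_def)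
  also have "\<dots> \<longleftrightarrow> r + p = p * r"
    using r p by (auto simp: field_simps)
  also have "\<dots> \<longleftrightarrow> q = conj_exponent p"
    using r p real by (auto simp: conj_exponent_def field_simps)
  finally show ?thesis by simp
next
  case PInf
  then show ?thesis using assms by (auto simp: conj_exponent_def one_ereal_def field_simps)
next
  case MInf
  then show ?thesis using assms by simp
qed

text \<open>
  The order \<open>q\<close> ranges over \<open>(1, \<infinity>]\<close>, and \<open>Q\<close> over probability measures on the same
  \<open>\<sigma>\<close>-algebra as \<open>M\<close>. For such \<open>Q\<close> the derivative \<^term>\<open>RN_deriv M Q\<close> is almost surely finite,
  so \<^const>\<open>enn2real\<close> loses nothing there, and both the \<open>q\<close>-th moment and the essential
  supremum are at least 1, so the real logarithm is applied to a positive number.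
\<close>

definition renyi_entropy :: "'a measure \<Rightarrow> ereal \<Rightarrow> 'a measure \<Rightarrow> ereal" where
  "renyi_entropy M q Q =
     (if \<not> absolutely_continuous M Q then \<infinity>
      else if q = \<infinity> then
        (let s = esssup M (RN_deriv M Q)
         in if s = \<infinity> then \<infinity> else ereal (ln (enn2real s)))
      else
        (let r = real_of_ereal q;
             m = (\<integral>\<^sup>+\<omega>. ennreal (enn2real (RN_deriv M Q \<omega>) powr r) \<partial>M)
         in if m = \<infinity> then \<infinity> else ereal (1 / (r - 1) * ln (enn2real m))))"

text \<open>
  For \<open>X\<close> in \<open>L\<^sup>p\<close> every \<open>Q\<close> satisfying the entropy constraint has its density in \<open>L\<^sup>q\<close>, so
  \<open>X\<close> is \<open>Q\<close>-integrable by Hoelder's inequality and the Bochner integral is the true expectation.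
\<close>

definition EVaR :: "'a measure \<Rightarrow> real \<Rightarrow> real \<Rightarrow> ('a \<Rightarrow> real) \<Rightarrow> ereal" where
  "EVaR M p \<alpha> X =
     (if \<alpha> = 1 then esssup M (\<lambda>\<omega>. ereal (X \<omega>))
      else (SUP Q \<in> {Q. prob_space Q \<and> sets Q = sets M \<and>
                      renyi_entropy M (conj_exponent p) Q \<le> ereal (ln (1 / (1 - \<alpha>)))}.
              ereal (\<integral>\<omega>. X \<omega> \<partial>Q)))"

definition Lambda_EVaR ::
  "'a measure \<Rightarrow> real \<Rightarrow> (real \<Rightarrow> real) \<Rightarrow> ('a \<Rightarrow> real) \<Rightarrow> ereal" where
  "Lambda_EVaR M p \<Lambda> X = (SUP x. min (EVaR M p (\<Lambda> x) X) (ereal x))"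

text \<open>Left-continuous quantile function; only its values on \<open>(0, 1)\<close> are meaningful.\<close>

definition quantile :: "'a measure \<Rightarrow> ('a \<Rightarrow> real) \<Rightarrow> real \<Rightarrow> real" where
  "quantile M X \<alpha> = Inf {x. \<alpha> \<le> cdf (distr M borel X) x}"

definition wasserstein ::
  "'a measure \<Rightarrow> real \<Rightarrow> ('a \<Rightarrow> real) \<Rightarrow> ('a \<Rightarrow> real) \<Rightarrow> ennreal" where
  "wasserstein M k X Y =
     (let c = (\<integral>\<^sup>+\<alpha>\<in>{0<..<1}. ennreal (\<bar>quantile M X \<alpha> - quantile M Y \<alpha>\<bar> powr k) \<partial>lborel)
      in if c = \<infinity> then \<infinity> else ennreal (enn2real c powr (1 / k)))"

end

theory Submission
  imports Defs
begin

text \<open>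
  Suprema over \<open>Y\<close> and over \<open>x\<close> commute with \<open>min\<close>, so one may fix \<open>\<alpha> = \<Lambda> x\<close> and show that the largest
  EVaR over the Wasserstein ball is \<open>EVaR X + \<delta> c\<close> with \<open>c = (1 - \<alpha>) powr (- 1 / p)\<close>. The EVaR is the
  supremum of \<open>E[Z X]\<close> over densities \<open>Z\<close> of \<open>L\<^sup>q\<close>-norm at most \<open>c\<close>; by conditioning, this supremum
  depends on the law of \<open>X\<close> only, hence it can be computed for the quantile function on the unit
  interval, where Hoelder's inequality gives the upper bound. For the lower bound, atomlessness
  allows one to move an almost optimal \<open>Z\<close> slightly so that its norm becomes exactly \<open>c\<close>; if \<open>h\<close>
  is the dual element, \<open>E[Z h] = c\<close> with \<open>h\<close> of \<open>L\<^sup>p\<close>-norm at most 1, then \<open>Y = X + \<delta> h\<close> is almost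
  optimal, because the Wasserstein distance is at most the \<open>L\<^sup>p\<close>-distance.
\<close>

subsection \<open>Densities with bounded dual norm\<close>

text \<open>Young's inequality for \<open>f / a\<close> and \<open>g / b\<close>, integrated. The
  bounds \<open>a\<close> and \<open>b\<close> stand in for the norms, so no integrability has to be
  shown beforehand.\<close>

lemma nn_integral_Holder:
  fixes f g :: "'a \<Rightarrow> real"
  assumes [measurable]: "f \<in> borel_measurable M" "g \<in> borel_measurable M"
    and p: "1 < p" and q: "1 < q" "1 / p + 1 / q = 1" and a: "0 \<le> a" and b: "0 \<le> b"
    and f: "(\<integral>\<^sup>+x. ennreal (\<bar>f x\<bar> powr p) \<partial>M) \<le> ennreal (a powr p)"
    and g: "(\<integral>\<^sup>+x. ennreal (\<bar>g x\<bar> powr q) \<partial>M) \<le> ennreal (b powr q)"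
  shows "(\<integral>\<^sup>+x. ennreal (\<bar>f x\<bar> * \<bar>g x\<bar>) \<partial>M) \<le> ennreal (a * b)"
proof -
  \<comment> \<open>Covers the degenerate case: a zero bound forces the function to vanish almost
    everywhere, where scaling by \<open>1 / a\<close> or \<open>1 / b\<close> would be
    meaningless.\<close>
  have zero: "AE x in M. h x = 0"
    if "(\<integral>\<^sup>+x. ennreal (\<bar>h x\<bar> powr r) \<partial>M) \<le> ennreal (0 powr r)" "h \<in> borel_measurable M" for h :: "'a \<Rightarrow> real" and r
  proof -
    have "(\<integral>\<^sup>+x. ennreal (\<bar>h x\<bar> powr r) \<partial>M) = 0" using that by simp
    then have "AE x in M. ennreal (\<bar>h x\<bar> powr r) = 0"
      using that(2) by (subst (asm) nn_integral_0_iff_AE) auto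
    then show ?thesis by eventually_elim (simp add: ennreal_eq_0_iff)
  qed
  have "AE x in M. \<bar>f x\<bar> * \<bar>g x\<bar> = 0" if "a = 0 \<or> b = 0"
  proof (cases "a = 0")
    case True
    then have "AE x in M. f x = 0" using f zero[of f p] by simp
    then show ?thesis by eventually_elim simp
  next
    case False
    then have "AE x in M. g x = 0" using g zero[of g q] that by simp
    then show ?thesis by eventually_elim simp
  qed
  then have *: ?thesis if "a = 0 \<or> b = 0"
    using that by (subst nn_integral_cong_AE[where v = "\<lambda>x. 0"]) (auto elim!: eventually_mono)
  show ?thesis
  proof (cases "a = 0 \<or> b = 0")
    case False
    then have ab: "0 < a" "0 < b" using a b by auto
    \<comment> \<open>\<open>u\<close> and \<open>v\<close> undo the scaling, so that the integrated
      bound becomes \<open>a * b * (1 / p + 1 / q)\<close>.\<close>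
    define u v where "u = a * b / (p * a powr p)" and "v = a * b / (q * b powr q)"
    have uv: "0 \<le> u" "0 \<le> v" using ab p q by (auto simp: u_def v_def)
    have "\<bar>f x\<bar> * \<bar>g x\<bar> \<le> u * \<bar>f x\<bar> powr p + v * \<bar>g x\<bar> powr q" for x
    proof -
      have "(\<bar>f x\<bar> / a) * (\<bar>g x\<bar> / b) \<le> (\<bar>f x\<bar> / a) powr p / p + (\<bar>g x\<bar> / b) powr q / q"
        using Youngs_inequality[of p q "\<bar>f x\<bar> / a" "\<bar>g x\<bar> / b"] p q ab by auto
      then have "a * b * ((\<bar>f x\<bar> / a) * (\<bar>g x\<bar> / b)) \<le>
          a * b * ((\<bar>f x\<bar> / a) powr p / p + (\<bar>g x\<bar> / b) powr q / q)"
        using ab by (intro mult_left_mono) auto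
      then show ?thesis
        using ab by (simp add: u_def v_def powr_divide algebra_simps)
    qed
    then have "(\<integral>\<^sup>+x. ennreal (\<bar>f x\<bar> * \<bar>g x\<bar>) \<partial>M) \<le>
        (\<integral>\<^sup>+x. ennreal u * ennreal (\<bar>f x\<bar> powr p) + ennreal v * ennreal (\<bar>g x\<bar> powr q) \<partial>M)"
      using uv by (intro nn_integral_mono)
        (auto simp flip: ennreal_mult ennreal_plus intro!: ennreal_leI)
    also have "\<dots> = ennreal u * (\<integral>\<^sup>+x. ennreal (\<bar>f x\<bar> powr p) \<partial>M) + ennreal v * (\<integral>\<^sup>+x. ennreal (\<bar>g x\<bar> powr q) \<partial>M)"
      by (simp add: nn_integral_add nn_integral_cmult)
    also have "\<dots> \<le> ennreal u * ennreal (a powr p) + ennreal v * ennreal (b powr q)"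
      by (intro add_mono mult_left_mono f g) auto
    also have "\<dots> = ennreal (u * a powr p + v * b powr q)"
      using uv by (simp add: ennreal_mult ennreal_plus)
    also have "u * a powr p + v * b powr q = a * b * (1 / p + 1 / q)"
      using ab p q by (simp add: u_def v_def field_simps)
    finally show ?thesis using q by simp
  qed (rule *)
qed

text \<open>For \<open>0 \<le> c\<close>, the densities of norm at most \<open>c\<close> in the
  exponent conjugate to \<open>p\<close>; when \<open>p = 1\<close> that norm is the essential
  supremum. Nonnegativity is imposed at every point, so that rewriting can be pointwise.\<close>

definition dual_ball :: "'a measure \<Rightarrow> real \<Rightarrow> real \<Rightarrow> ('a \<Rightarrow> real) set" where
  "dual_ball M p c = {Z \<in> borel_measurable M. (\<forall>x. 0 \<le> Z x) \<and> (\<integral>\<^sup>+x. ennreal (Z x) \<partial>M) = 1 \<and>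
     (if p = 1 then AE x in M. Z x \<le> c
      else (\<integral>\<^sup>+x. ennreal (Z x powr (p / (p - 1))) \<partial>M) \<le> ennreal (c powr (p / (p - 1))))}"

text \<open>A pointwise bound for \<open>p = 1\<close>, and otherwise Hoelder's inequality with
  \<open>Z\<close> in the role of \<open>f\<close>. Later proofs use it to treat both kinds of dual
  norm at once.\<close>

lemma dual_ball_Holder:
  assumes Z: "Z \<in> dual_ball M p c" and [measurable]: "f \<in> borel_measurable M"
    and p: "1 \<le> p" and c: "0 \<le> c" and s: "0 \<le> s"
    and f: "(\<integral>\<^sup>+x. ennreal (\<bar>f x\<bar> powr p) \<partial>M) \<le> ennreal (s powr p)"
  shows "(\<integral>\<^sup>+x. ennreal (Z x * \<bar>f x\<bar>) \<partial>M) \<le> ennreal (c * s)"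
proof -
  have [measurable]: "Z \<in> borel_measurable M" and nn: "\<And>x. 0 \<le> Z x"
    using Z by (auto simp: dual_ball_def)
  show ?thesis
  proof (cases "p = 1")
    case True
    then have "AE x in M. Z x \<le> c" using Z by (auto simp: dual_ball_def)
    then have "(\<integral>\<^sup>+x. ennreal (Z x * \<bar>f x\<bar>) \<partial>M) \<le> (\<integral>\<^sup>+x. ennreal c * ennreal \<bar>f x\<bar> \<partial>M)"
      by (intro nn_integral_mono_AE, eventually_elim)
        (auto simp: c ennreal_mult[symmetric] intro!: ennreal_leI mult_right_mono)
    also have "\<dots> = ennreal c * (\<integral>\<^sup>+x. ennreal \<bar>f x\<bar> \<partial>M)"
      by (simp add: nn_integral_cmult)
    also have "\<dots> \<le> ennreal c * ennreal s"
      using f True s by (intro mult_left_mono) auto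
    finally show ?thesis using c s by (simp add: ennreal_mult)
  next
    case False
    then have p1: "1 < p" using p by simp
    have "(\<integral>\<^sup>+x. ennreal (\<bar>Z x\<bar> * \<bar>f x\<bar>) \<partial>M) \<le> ennreal (c * s)"
      by (rule nn_integral_Holder[where p = "p / (p - 1)" and q = p])
        (use Z False p1 c s f nn in \<open>auto simp: dual_ball_def field_simps\<close>)
    then show ?thesis using nn by simp
  qed
qed

text \<open>Testing only against functions of \<open>Z\<close> itself suffices, by the truncations of \<open>Z powr (q - 1)\<close>.\<close>

lemma dual_ballI:
  assumes [measurable]: "Z \<in> borel_measurable M" and nn: "\<And>x. 0 \<le> Z x"
    and one: "(\<integral>\<^sup>+x. ennreal (Z x) \<partial>M) = 1"
    and fin: "finite_measure M" and p: "1 \<le> p" and c: "0 \<le> c"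
    and test: "\<And>k s. \<lbrakk>k \<in> borel_measurable borel; \<And>z. 0 \<le> k z; 0 \<le> s;
       (\<integral>\<^sup>+x. ennreal (k (Z x) powr p) \<partial>M) \<le> ennreal (s powr p)\<rbrakk> \<Longrightarrow>
       (\<integral>\<^sup>+x. ennreal (Z x * k (Z x)) \<partial>M) \<le> ennreal (c * s)"
  shows "Z \<in> dual_ball M p c"
proof (cases "p = 1")
  case True
  interpret finite_measure M by fact
  \<comment> \<open>For \<open>p = 1\<close> the test function marks the set \<open>A\<close> where
    \<open>Z\<close> exceeds \<open>c\<close>; its norm \<open>s\<close> is the measure of
    \<open>A\<close>.\<close>
  define k :: "real \<Rightarrow> real" where "k = indicator {c<..}"
  define A where "A = {x \<in> space M. c < Z x}"
  have [measurable]: "A \<in> sets M" by (simp add: A_def)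
  have k: "k (Z x) = indicator A x" if "x \<in> space M" for x
    using that by (auto simp: k_def A_def indicator_def)
  have kp: "k (Z x) powr p = k (Z x)" for x using True by (simp add: k_def indicator_def)
  have kA: "(\<integral>\<^sup>+x. ennreal (k (Z x)) \<partial>M) = ennreal (measure M A)"
    using k by (subst nn_integral_cong[where v = "indicator A"])
      (auto simp: emeasure_eq_measure indicator_def)
  have "(\<integral>\<^sup>+x. ennreal (Z x * k (Z x)) \<partial>M) \<le> ennreal (c * measure M A)"
    by (rule test) (auto simp: True k_def kA[unfolded k_def])
  also have "ennreal (c * measure M A) = (\<integral>\<^sup>+x. ennreal (c * k (Z x)) \<partial>M)"
    using c kA by (simp add: ennreal_mult' nn_integral_cmult k_def)
  finally have le: "(\<integral>\<^sup>+x. ennreal (Z x * k (Z x)) \<partial>M) \<le> (\<integral>\<^sup>+x. ennreal (c * k (Z x)) \<partial>M)" .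
  have int: "(\<integral>\<^sup>+x. ennreal (c * k (Z x)) \<partial>M) \<noteq> \<infinity>"
    unfolding \<open>ennreal (c * measure M A) = _\<close>[symmetric] by simp
  have ge: "c * k (Z x) \<le> Z x * k (Z x)" for x
    by (auto simp: k_def indicator_def)
  \<comment> \<open>The integrand is positive wherever \<open>c < Z x\<close>, so a vanishing
    integral makes that set null.\<close>
  have "(\<integral>\<^sup>+x. (ennreal (Z x * k (Z x)) - ennreal (c * k (Z x))) \<partial>M) =
      (\<integral>\<^sup>+x. ennreal (Z x * k (Z x)) \<partial>M) - (\<integral>\<^sup>+x. ennreal (c * k (Z x)) \<partial>M)"
    using int ge by (intro nn_integral_diff) (auto simp: k_def[abs_def] intro!: ennreal_leI)
  also have "\<dots> = 0" using le int by (simp add: diff_eq_0_iff_ennreal less_top)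
  finally have "AE x in M. ennreal (Z x * k (Z x)) - ennreal (c * k (Z x)) = 0"
    by (subst (asm) nn_integral_0_iff_AE) (auto simp: k_def[abs_def])
  then have "AE x in M. Z x \<le> c"
    by eventually_elim (auto simp: k_def indicator_def of_bool_def nn c diff_eq_0_iff_ennreal split: if_splits)
  then show ?thesis using True one nn by (simp add: dual_ball_def)
next
  case False
  interpret finite_measure M by fact
  define q where "q = p / (p - 1)"
  have p1: "1 < p" using p False by simp
  then have q: "1 < q" and qp: "(q - 1) * p = q" by (auto simp: q_def field_simps)
  have trunc: "(\<integral>\<^sup>+x. ennreal (min (Z x) (real n) powr q) \<partial>M) \<le> ennreal (c powr q)" for n :: nat
  proof -
    \<comment> \<open>As \<open>(q - 1) * p = q\<close>, the p-norm of \<open>k (Z x)\<close> is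
      \<open>a powr (1 / p)\<close>. Truncation at \<open>n\<close> keeps \<open>a\<close> finite,
      so \<open>a \<le> c * a powr (1 / p)\<close> can be divided to give
      \<open>a powr (1 / q) \<le> c\<close>.\<close>
    define k :: "real \<Rightarrow> real" where "k z = (min (max z 0) n) powr (q - 1)" for z
    define a where "a = (\<integral>x. min (Z x) n powr q \<partial>M)"
    have int: "integrable M (\<lambda>x. min (Z x) n powr q)"
      by (rule integrable_const_bound[where B = "n powr q"])
        (use q nn in \<open>auto intro!: powr_mono2\<close>)
    have a: "(\<integral>\<^sup>+x. ennreal (min (Z x) n powr q) \<partial>M) = ennreal a" "0 \<le> a"
      unfolding a_def using int by (auto intro!: nn_integral_eq_integral integral_nonneg_AE)
    have "ennreal a \<le> (\<integral>\<^sup>+x. ennreal (Z x * k (Z x)) \<partial>M)"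
      unfolding a(1)[symmetric]
    proof (intro nn_integral_mono ennreal_leI)
      fix x
      have "min (Z x) n powr q = min (Z x) n * k (Z x)"
        using nn[of x] by (cases "min (Z x) n = 0") (auto simp: k_def powr_mult_base)
      also have "\<dots> \<le> Z x * k (Z x)" by (intro mult_right_mono) (auto simp: k_def)
      finally show "min (Z x) n powr q \<le> Z x * k (Z x)" .
    qed
    also have "\<dots> \<le> ennreal (c * a powr (1 / p))"
    proof (rule test)
      have "(\<integral>\<^sup>+x. ennreal (k (Z x) powr p) \<partial>M) = ennreal a"
        unfolding a(1)[symmetric] k_def powr_powr qp using nn by (simp add: max_absorb1)
      then show "(\<integral>\<^sup>+x. ennreal (k (Z x) powr p) \<partial>M) \<le> ennreal ((a powr (1 / p)) powr p)"
        using a p1 by (simp add: powr_powr)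
    qed (auto simp: k_def[abs_def])
    finally have le: "a \<le> c * a powr (1 / p)"
      using c a by (subst (asm) ennreal_le_iff) auto
    have "a \<le> c powr q"
    proof (cases "a = 0")
      case False
      then have "0 < a" using a by simp
      have "a powr (1 / q) = a / a powr (1 / p)"
      proof -
        have "1 / q = 1 - 1 / p" using p1 by (simp add: q_def field_simps)
        then show ?thesis using \<open>0 < a\<close> by (simp add: powr_diff)
      qed
      also have "\<dots> \<le> c" using le \<open>0 < a\<close> by (simp add: field_simps)
      finally have "(a powr (1 / q)) powr q \<le> c powr q" using q by (intro powr_mono2) auto
      then show ?thesis using \<open>0 < a\<close> q by (simp add: powr_powr)
    qed simp
    then show ?thesis using a by (simp add: ennreal_leI)
  qed
  \<comment> \<open>Fatou's lemma; at each point the truncations are eventually equal to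
    \<open>Z\<close>.\<close>
  have "(\<integral>\<^sup>+x. ennreal (Z x powr q) \<partial>M) \<le> liminf (\<lambda>n. \<integral>\<^sup>+x. ennreal (min (Z x) (real n) powr q) \<partial>M)"
  proof -
    have "ennreal (Z x powr q) = liminf (\<lambda>n. ennreal (min (Z x) (real n) powr q))" for x
    proof (rule lim_imp_Liminf[symmetric])
      have "eventually (\<lambda>n. ennreal (min (Z x) (real n) powr q) = ennreal (Z x powr q)) sequentially"
        using eventually_ge_at_top[of "nat \<lceil>Z x\<rceil>"]
        by eventually_elim (simp add: min_def nat_le_iff ceiling_le_iff le_nat_iff)
      then show "(\<lambda>n. ennreal (min (Z x) (real n) powr q)) \<longlonglongrightarrow> ennreal (Z x powr q)"
        by (rule tendsto_eventually)
    qed simp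
    then show ?thesis by (simp add: nn_integral_liminf)
  qed
  also have "\<dots> \<le> ennreal (c powr q)"
    by (rule Liminf_le, simp, rule always_eventually) (use trunc in blast)
  finally show ?thesis using False one nn by (simp add: dual_ball_def q_def)
qed

lemma dual_ball_prob_space:
  assumes "Z \<in> dual_ball M p c"
  shows "prob_space (density M Z)"
  using assms by (intro prob_spaceI) (auto simp: dual_ball_def emeasure_density cong: nn_integral_cong)

text \<open>The new density is the conditional expectation of \<open>Z\<close> given \<open>X1\<close>, read off as a function of
  the value of \<open>X1\<close>; conditioning does not increase the norm.\<close>

lemma dual_ball_transfer:
  fixes X1 :: "'a \<Rightarrow> real" and X2 :: "'b \<Rightarrow> real"
  assumes "prob_space N1" "prob_space N2"
    and [measurable]: "X1 \<in> borel_measurable N1" "X2 \<in> borel_measurable N2"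
    and law: "distr N1 borel X1 = distr N2 borel X2"
    and Z: "Z \<in> dual_ball N1 p c" and p: "1 \<le> p" and c: "0 \<le> c"
  obtains Z' where "Z' \<in> dual_ball N2 p c"
    and "distr (density N2 Z') borel X2 = distr (density N1 Z) borel X1"
proof -
  interpret N1: prob_space N1 by fact
  interpret N2: prob_space N2 by fact
  have Zm[measurable]: "Z \<in> borel_measurable N1" and Znn: "\<And>x. 0 \<le> Z x"
    using Z by (auto simp: dual_ball_def)
  interpret D: prob_space "density N1 Z" using Z by (rule dual_ball_prob_space)
  define \<mu> \<nu> where "\<mu> = distr N2 borel X2" and "\<nu> = distr (density N1 Z) borel X1"
  interpret \<mu>: prob_space \<mu> unfolding \<mu>_def by (rule N2.prob_space_distr) simp
  interpret \<nu>: prob_space \<nu> unfolding \<nu>_def by (rule D.prob_space_distr) simp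
  have sets[simp]: "sets \<mu> = sets borel" "sets \<nu> = sets borel" "space \<mu> = UNIV"
    by (auto simp: \<mu>_def \<nu>_def)
  have bm[simp]: "borel_measurable \<mu> = borel_measurable borel"
    by (rule measurable_cong_sets) auto
  \<comment> \<open>A Borel set that is null for the common law has a null preimage under
    \<open>X1\<close>, and weighting by \<open>Z\<close> keeps it null.\<close>
  have ac: "absolutely_continuous \<mu> \<nu>"
    unfolding absolutely_continuous_def
  proof
    fix B assume "B \<in> null_sets \<mu>"
    then have B[measurable]: "B \<in> sets borel" and 0: "emeasure \<mu> B = 0"
      by auto
    have "emeasure N1 (X1 -` B \<inter> space N1) = 0"
      using 0 unfolding \<mu>_def law[symmetric] by (simp add: emeasure_distr)
    then have "AE x in N1. X1 x \<notin> B"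
      by (intro AE_I[of _ _ "X1 -` B \<inter> space N1"]) auto
    then have "(\<integral>\<^sup>+x. ennreal (Z x) * indicator (X1 -` B \<inter> space N1) x \<partial>N1) = 0"
      by (subst nn_integral_0_iff_AE) (auto elim!: eventually_mono simp: indicator_def)
    then show "B \<in> null_sets \<nu>"
      by (auto simp: \<nu>_def emeasure_distr emeasure_density)
  qed
  \<comment> \<open>The conditional expectation of \<open>Z\<close> given \<open>X1 = x\<close>, as
    the density of the weighted law relative to the common law.\<close>
  define g where "g x = enn2real (RN_deriv \<mu> \<nu> x)" for x
  have g[measurable]: "g \<in> borel_measurable borel"
    unfolding g_def bm[symmetric] by measurable
  have "AE x in \<mu>. RN_deriv \<mu> \<nu> x \<noteq> \<infinity>"
    by (rule \<mu>.RN_deriv_finite[OF _ ac]) (auto intro: \<nu>.sigma_finite_measure_axioms)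
  then have "density \<mu> g = density \<mu> (RN_deriv \<mu> \<nu>)"
    using borel_measurable_RN_deriv[of \<mu> \<nu>]
    by (intro density_cong) (auto elim!: eventually_mono simp: g_def less_top)
  then have dg: "density \<mu> g = \<nu>"
    using \<mu>.density_RN_deriv[OF ac] by simp
  define Z' where "Z' x = g (X2 x)" for x
  have Z'm[measurable]: "Z' \<in> borel_measurable N2" unfolding Z'_def by measurable
  have Z'nn: "0 \<le> Z' x" for x by (simp add: Z'_def g_def)
  have dZ': "distr (density N2 Z') borel X2 = \<nu>"
    unfolding dg[symmetric] \<mu>_def Z'_def by (subst density_distr) auto
  have int: "(\<integral>\<^sup>+x. ennreal (Z' x) * f (X2 x) \<partial>N2) = (\<integral>\<^sup>+x. ennreal (Z x) * f (X1 x) \<partial>N1)"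
    if [measurable]: "f \<in> borel_measurable borel" for f
  proof -
    have "(\<integral>\<^sup>+x. f x \<partial>distr (density N2 Z') borel X2) = (\<integral>\<^sup>+x. f x \<partial>\<nu>)" by (simp add: dZ')
    then show ?thesis
      unfolding \<nu>_def by (simp add: nn_integral_distr nn_integral_density)
  qed
  have law': "(\<integral>\<^sup>+x. f (X2 x) \<partial>N2) = (\<integral>\<^sup>+x. f (X1 x) \<partial>N1)"
    if [measurable]: "f \<in> borel_measurable borel" for f :: "real \<Rightarrow> ennreal"
    using arg_cong[OF law, of "\<lambda>M. \<integral>\<^sup>+x. f x \<partial>M"] by (simp add: nn_integral_distr)
  have "Z' \<in> dual_ball N2 p c"
  proof (rule dual_ballI)
    show "(\<integral>\<^sup>+x. ennreal (Z' x) \<partial>N2) = 1"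
      using int[of "\<lambda>_. 1"] Z by (simp add: dual_ball_def)
    fix k :: "real \<Rightarrow> real" and s
    assume [measurable]: "k \<in> borel_measurable borel" and k: "\<And>z. 0 \<le> k z" and s: "0 \<le> s"
      and le: "(\<integral>\<^sup>+x. ennreal (k (Z' x) powr p) \<partial>N2) \<le> ennreal (s powr p)"
    \<comment> \<open>A function of \<open>Z'\<close> is a function of \<open>X2\<close>, so the
      pairing moves to \<open>N1\<close>, where Hoelder's inequality for \<open>Z\<close>
      applies.\<close>
    have "(\<integral>\<^sup>+x. ennreal (Z' x * k (Z' x)) \<partial>N2) = (\<integral>\<^sup>+x. ennreal (Z x * \<bar>k (g (X1 x))\<bar>) \<partial>N1)"
      using int[of "\<lambda>x. ennreal (k (g x))"] k Znn Z'nn by (simp add: Z'_def[abs_def] ennreal_mult)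
    also have "\<dots> \<le> ennreal (c * s)"
      by (rule dual_ball_Holder[OF Z _ p c s])
        (use le law'[of "\<lambda>x. ennreal (k (g x) powr p)"] k in \<open>auto simp: Z'_def\<close>)
    finally show "(\<integral>\<^sup>+x. ennreal (Z' x * k (Z' x)) \<partial>N2) \<le> ennreal (c * s)" .
  qed (use Z'nn p c N2.finite_measure_axioms in auto)
  with dZ' show thesis by (intro that) (simp_all add: \<nu>_def)
qed

section \<open>Renyi entropy constraints as balls of the dual norm\<close>

text \<open>Exponentiating the constraint bounds the essential supremum by
  \<open>1 / (1 - \<alpha>)\<close> if \<open>p = 1\<close>. Otherwise it bounds the q-th moment by
  \<open>(1 / (1 - \<alpha>)) powr (q - 1)\<close>, where
  \<open>q - 1 = 1 / (p - 1) = q / p\<close>.\<close>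

lemma renyi_entropy_le_iff_dual_ball:
  fixes Z :: "'a \<Rightarrow> real"
  assumes "prob_space M" and [measurable]: "Z \<in> borel_measurable M" and nn: "\<And>x. 0 \<le> Z x"
    and one: "(\<integral>\<^sup>+x. ennreal (Z x) \<partial>M) = 1" and p: "1 \<le> p" and \<alpha>: "0 \<le> \<alpha>" "\<alpha> < 1"
  shows "renyi_entropy M (conj_exponent p) (density M Z) \<le> ereal (ln (1 / (1 - \<alpha>))) \<longleftrightarrow>
    Z \<in> dual_ball M p ((1 - \<alpha>) powr (- 1 / p))"
proof -
  interpret prob_space M by fact
  define R where "R = RN_deriv M (density M Z)"
  have [measurable]: "R \<in> borel_measurable M" by (simp add: R_def)
  have R: "AE x in M. ennreal (Z x) = R x"
    unfolding R_def by (rule RN_deriv_unique) auto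
  have ac: "absolutely_continuous M (density M Z)"
    by (rule absolutely_continuousI_density) simp
  \<comment> \<open>For \<open>s = 0\<close> the left side compares the default value
    \<open>ln 0 = 0\<close> with \<open>ln u\<close>, which is nonnegative since
    \<open>1 \<le> u\<close>.\<close>
  have ln_le: "ln (enn2real s) \<le> ln u \<longleftrightarrow> s \<le> ennreal u" if "s \<noteq> \<infinity>" "1 \<le> u" for s u
    using that by (cases s) (auto simp: le_less ennreal_less_iff)
  show ?thesis
  proof (cases "p = 1")
    case True
    have AE: "esssup M R \<le> ennreal u \<longleftrightarrow> (AE x in M. Z x \<le> u)" if "0 \<le> u" for u
    proof
      assume le: "esssup M R \<le> ennreal u"
      show "AE x in M. Z x \<le> u" using R esssup_AE[of R M]
        by eventually_elim (metis le order_trans ennreal_le_iff that)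
    next
      assume "AE x in M. Z x \<le> u"
      with R have "AE x in M. R x \<le> ennreal u" by eventually_elim (metis ennreal_leI)
      then show "esssup M R \<le> ennreal u" by (intro esssup_I) auto
    qed
    have "renyi_entropy M (conj_exponent p) (density M Z) \<le> ereal (ln (1 / (1 - \<alpha>))) \<longleftrightarrow>
        esssup M R \<le> ennreal (1 / (1 - \<alpha>))"
    proof (cases "esssup M R = \<infinity>")
      case False
      then show ?thesis
        using ac True \<alpha> ln_le[OF False, of "1 / (1 - \<alpha>)"]
        by (simp add: renyi_entropy_def conj_exponent_def R_def Let_def del: ln_div)
    qed (use ac True in \<open>auto simp: renyi_entropy_def conj_exponent_def R_def top_unique\<close>)
    also have "\<dots> \<longleftrightarrow> (AE x in M. Z x \<le> 1 / (1 - \<alpha>))" using \<alpha> by (intro AE) auto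
    finally show ?thesis
      using True one nn \<alpha> by (simp add: dual_ball_def powr_minus divide_inverse)
  next
    case False
    define q where "q = p / (p - 1)"
    define m where "m = (\<integral>\<^sup>+x. ennreal (Z x powr q) \<partial>M)"
    have p1: "1 < p" using False p by simp
    have m: "(\<integral>\<^sup>+x. ennreal (enn2real (R x) powr q) \<partial>M) = m"
      unfolding m_def
    proof (rule nn_integral_cong_AE)
      show "AE x in M. ennreal (enn2real (R x) powr q) = ennreal (Z x powr q)"
        using R by eventually_elim (metis enn2real_ennreal nn)
    qed
    \<comment> \<open>The exponentiated entropy bound; \<open>uc\<close> identifies it with the q-th
      power of the radius of the dual ball.\<close>
    define u where "u = (1 / (1 - \<alpha>)) powr (1 / (p - 1))"
    have u: "1 \<le> u" unfolding u_def using \<alpha> p1 by (intro ge_one_powr_ge_zero) auto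
    have lnu: "(p - 1) * ln u = ln (1 / (1 - \<alpha>))" unfolding u_def using p1 \<alpha> by (simp add: ln_powr)
    have uc: "u = ((1 - \<alpha>) powr (- 1 / p)) powr q"
    proof -
      have inv: "1 / (1 - \<alpha>) = (1 - \<alpha>) powr (-1)" using \<alpha> by (simp add: powr_minus divide_inverse)
      show ?thesis unfolding u_def inv powr_powr using p1 by (simp add: q_def)
    qed
    have r: "1 / (real_of_ereal (conj_exponent p) - 1) = p - 1" "real_of_ereal (conj_exponent p) = q"
      "conj_exponent p \<noteq> \<infinity>"
      using p1 by (auto simp: conj_exponent_def q_def field_simps)
    have "renyi_entropy M (conj_exponent p) (density M Z) \<le> ereal (ln (1 / (1 - \<alpha>))) \<longleftrightarrow> m \<le> ennreal u"
    proof (cases "m = \<infinity>")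
      case True
      then show ?thesis using ac r m by (simp add: renyi_entropy_def Let_def R_def top_unique)
    next
      case False
      have "renyi_entropy M (conj_exponent p) (density M Z) = ereal ((p - 1) * ln (enn2real m))"
        using ac r m False by (simp add: renyi_entropy_def Let_def R_def)
      then show ?thesis
        using p1 ln_le[OF False u] by (simp flip: lnu)
    qed
    then show ?thesis
      using False one nn by (simp add: dual_ball_def uc m_def q_def)
  qed
qed

text \<open>An admissible \<open>Q\<close> has finite entropy, hence an almost surely finite
  derivative, whose real version lies in the dual ball. Conversely each element of the ball is the
  density of an admissible \<open>Q\<close>.\<close>

lemma EVaR_eq_SUP_dual_ball:
  assumes "prob_space M" and [measurable]: "X \<in> borel_measurable M"
    and p: "1 \<le> p" and \<alpha>: "0 \<le> \<alpha>" "\<alpha> < 1"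
  shows "EVaR M p \<alpha> X =
    (SUP Z \<in> dual_ball M p ((1 - \<alpha>) powr (- 1 / p)). ereal (\<integral>x. Z x * X x \<partial>M))"
proof -
  interpret prob_space M by fact
  define QQ where "QQ = {Q. prob_space Q \<and> sets Q = sets M \<and>
    renyi_entropy M (conj_exponent p) Q \<le> ereal (ln (1 / (1 - \<alpha>)))}"
  have "QQ = (\<lambda>Z. density M (\<lambda>x. ennreal (Z x))) ` dual_ball M p ((1 - \<alpha>) powr (- 1 / p))"
  proof (intro equalityI subsetI)
    fix Q assume "Q \<in> QQ"
    then have Q: "prob_space Q" "sets Q = sets M"
      and H: "renyi_entropy M (conj_exponent p) Q \<le> ereal (ln (1 / (1 - \<alpha>)))"
      by (auto simp: QQ_def)
    interpret Q: prob_space Q by fact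
    have ac: "absolutely_continuous M Q" using H by (auto simp: renyi_entropy_def split: if_splits)
    define Z where "Z x = enn2real (RN_deriv M Q x)" for x
    have Zm[measurable]: "Z \<in> borel_measurable M" unfolding Z_def by measurable
    have "AE x in M. RN_deriv M Q x \<noteq> \<infinity>"
      by (rule RN_deriv_finite[OF _ ac Q(2)]) (rule Q.sigma_finite_measure_axioms)
    then have "density M Z = density M (RN_deriv M Q)"
      by (intro density_cong) (auto elim!: eventually_mono simp: Z_def less_top)
    then have QZ: "density M Z = Q"
      using density_RN_deriv[OF ac Q(2)] by simp
    have "(\<integral>\<^sup>+x. ennreal (Z x) \<partial>M) = emeasure (density M Z) (space M)"
      by (auto simp: emeasure_density intro!: nn_integral_cong)
    also have "\<dots> = 1" unfolding QZ using Q.emeasure_space_1 sets_eq_imp_space_eq[OF Q(2)] by simp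
    finally have one: "(\<integral>\<^sup>+x. ennreal (Z x) \<partial>M) = 1" .
    have "Z \<in> dual_ball M p ((1 - \<alpha>) powr (- 1 / p))"
      using renyi_entropy_le_iff_dual_ball[OF assms(1) Zm _ one p \<alpha>] H QZ
      by (auto simp: Z_def[abs_def])
    then show "Q \<in> (\<lambda>Z. density M (\<lambda>x. ennreal (Z x))) ` dual_ball M p ((1 - \<alpha>) powr (- 1 / p))"
      using QZ by auto
  next
    fix Q assume "Q \<in> (\<lambda>Z. density M (\<lambda>x. ennreal (Z x))) ` dual_ball M p ((1 - \<alpha>) powr (- 1 / p))"
    then obtain Z where Q: "Q = density M Z" and Z: "Z \<in> dual_ball M p ((1 - \<alpha>) powr (- 1 / p))" by auto
    then show "Q \<in> QQ"
      using dual_ball_prob_space[OF Z] renyi_entropy_le_iff_dual_ball[OF assms(1) _ _ _ p \<alpha>, of Z]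
      by (auto simp: QQ_def dual_ball_def)
  qed
  moreover have "EVaR M p \<alpha> X = (SUP Q \<in> QQ. ereal (\<integral>\<omega>. X \<omega> \<partial>Q))"
    using \<alpha> by (simp add: EVaR_def QQ_def)
  ultimately show ?thesis
    by (auto simp: image_image dual_ball_def integral_real_density intro!: SUP_cong)
qed

text \<open>The witness is the norm of \<open>X\<close>, in the form in which the Hoelder lemmas
  take it as hypothesis.\<close>

lemma Lp_norm_exists:
  assumes X: "X \<in> Lp M p" and p: "0 < p"
  obtains s where "0 \<le> s" "(\<integral>\<^sup>+x. ennreal (\<bar>X x\<bar> powr p) \<partial>M) = ennreal (s powr p)"
proof -
  define a where "a = (\<integral>x. \<bar>X x\<bar> powr p \<partial>M)"
  have a: "0 \<le> a" "(\<integral>\<^sup>+x. ennreal (\<bar>X x\<bar> powr p) \<partial>M) = ennreal a"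
    using X unfolding a_def Lp_def by (auto intro!: nn_integral_eq_integral integral_nonneg_AE)
  show thesis
    by (rule that[of "a powr (1 / p)"]) (use a p in \<open>auto simp: powr_powr\<close>)
qed

lemma integrable_dual_ball_mult:
  assumes Z: "Z \<in> dual_ball M p c" and X: "X \<in> Lp M p" and p: "1 \<le> p" and c: "0 \<le> c"
  shows "integrable M (\<lambda>x. Z x * X x)"
proof -
  have [measurable]: "X \<in> borel_measurable M" "Z \<in> borel_measurable M" and nn: "\<And>x. 0 \<le> Z x"
    using X Z by (auto simp: Lp_def dual_ball_def)
  obtain s where s: "0 \<le> s" "(\<integral>\<^sup>+x. ennreal (\<bar>X x\<bar> powr p) \<partial>M) = ennreal (s powr p)"
    using Lp_norm_exists[OF X] p by auto
  have "(\<integral>\<^sup>+x. ennreal (Z x * \<bar>X x\<bar>) \<partial>M) \<le> ennreal (c * s)"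
    by (rule dual_ball_Holder[OF Z _ p c]) (use s in auto)
  also have "\<dots> < \<infinity>" by simp
  finally show ?thesis
    using nn by (intro integrableI_bounded) (auto simp: abs_mult)
qed

subsection \<open>Quantile functions and the Wasserstein distance\<close>

text \<open>The common space for all quantile functions: two of them, taken together on it, form the
  comonotone coupling.\<close>

abbreviation unit_interval :: "real measure" where
  "unit_interval \<equiv> restrict_space lborel {0<..<1}"

lemma prob_space_unit_interval: "prob_space unit_interval"
  by (auto simp add: emeasure_restrict_space space_restrict_space intro!: prob_spaceI)

context
  fixes M :: "'a measure" and X :: "'a \<Rightarrow> real"
  assumes M: "prob_space M" and X[measurable]: "X \<in> borel_measurable M"
begin

text \<open>Gives access to the locale behind Skorohod's theorem, whose pseudoinverse
  \<open>I\<close> of the distribution function is the quantile function.\<close>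

lemma cdf_distribution_distr: "cdf_distribution (distr M borel X)"
  unfolding cdf_distribution_def by (rule prob_space.real_distribution_distr[OF M]) simp

lemma quantile_le_iff: "quantile M X \<alpha> \<le> x \<longleftrightarrow> \<alpha> \<le> cdf (distr M borel X) x"
  if "0 < \<alpha>" "\<alpha> < 1"
proof -
  interpret cdf_distribution "distr M borel X" by (rule cdf_distribution_distr)
  show ?thesis using that pseudoinverse[of \<alpha> x] by (simp add: quantile_def)
qed

lemma measurable_quantile: "quantile M X \<in> borel_measurable unit_interval"
proof -
  interpret cdf_distribution "distr M borel X" by (rule cdf_distribution_distr)
  have "I \<in> borel_measurable unit_interval"
    by (rule measurable_cong_sets[THEN equalityD1, THEN subsetD, OF _ refl measurable_CI])
      (auto simp: sets_restrict_space)
  then show ?thesis by (simp add: quantile_def[abs_def])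
qed

text \<open>Inverse transform sampling; it allows questions about laws to be settled on the unit
  interval.\<close>

lemma distr_quantile: "distr unit_interval borel (quantile M X) = distr M borel X"
proof -
  interpret cdf_distribution "distr M borel X" by (rule cdf_distribution_distr)
  show ?thesis using distr_I_eq_M by (simp add: quantile_def[abs_def])
qed

lemma nn_integral_quantile:
  assumes [measurable]: "f \<in> borel_measurable borel"
  shows "(\<integral>\<^sup>+u. f (quantile M X u) \<partial>unit_interval) = (\<integral>\<^sup>+x. f (X x) \<partial>M)"
  using arg_cong[OF distr_quantile, of "\<lambda>M. \<integral>\<^sup>+x. f x \<partial>M"] measurable_quantile
  by (simp add: nn_integral_distr)

lemma quantile_in_Lp: "X \<in> Lp M p \<Longrightarrow> quantile M X \<in> Lp unit_interval p"
  using nn_integral_quantile[of "\<lambda>x. ennreal (\<bar>x\<bar> powr p)"] measurable_quantile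
  by (auto simp: Lp_def integrable_iff_bounded)

end

section \<open>Comparison of the Wasserstein distance with the distance in
  \<open>L^p\<close>\<close>

lemma wasserstein_le_iff:
  assumes "1 \<le> p" "0 \<le> \<delta>"
  shows "wasserstein M p X Y \<le> ennreal \<delta> \<longleftrightarrow>
    (\<integral>\<^sup>+u. ennreal (\<bar>quantile M X u - quantile M Y u\<bar> powr p) \<partial>unit_interval) \<le> ennreal (\<delta> powr p)"
proof -
  define I where "I = (\<integral>\<^sup>+u. ennreal (\<bar>quantile M X u - quantile M Y u\<bar> powr p) \<partial>unit_interval)"
  have "I = (\<integral>\<^sup>+\<alpha>\<in>{0<..<1}. ennreal (\<bar>quantile M X \<alpha> - quantile M Y \<alpha>\<bar> powr p) \<partial>lborel)"
    unfolding I_def by (subst nn_integral_restrict_space) auto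
  then have W: "wasserstein M p X Y = (if I = \<infinity> then \<infinity> else ennreal (enn2real I powr (1 / p)))"
    by (simp add: wasserstein_def Let_def)
  have "r powr (1 / p) \<le> \<delta> \<longleftrightarrow> r \<le> \<delta> powr p" if "0 \<le> r" for r
  proof -
    have "(r powr (1 / p)) powr p = r" "(\<delta> powr p) powr (1 / p) = \<delta>"
      using that assms by (simp_all add: powr_powr)
    then show ?thesis
      using powr_mono2[of p "r powr (1 / p)" \<delta>] powr_mono2[of "1 / p" r "\<delta> powr p"] that assms by auto
  qed
  then show ?thesis
    unfolding W I_def[symmetric] using assms by (cases I) (auto simp: top_unique)
qed

text \<open>Taylor's formula at 0 with integral remainder, the weights being the second derivative
  of the power. Since \<open>ennreal\<close> sends negative numbers to 0,
  \<open>ennreal (d - r)\<close> is a hinge, and powers are mixtures of hinges.\<close>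

lemma nn_integral_hinge:
  assumes d: "0 \<le> d" and p: "1 < p"
  shows "(\<integral>\<^sup>+r\<in>{0<..}. ennreal (p * (p - 1) * r powr (p - 2)) * ennreal (d - r) \<partial>lborel) = ennreal (d powr p)"
proof -
  \<comment> \<open>The exponent exceeds -1, so the singularity at 0 for \<open>p < 2\<close> is
    integrable.\<close>
  have "((\<lambda>r. r powr (p - 2)) has_integral (d powr (p - 1) / (p - 1))) {0..d}"
    using has_integral_powr_from_0[of "p - 2" d] p d by (simp add: algebra_simps)
  moreover have "((\<lambda>r. r powr (p - 1)) has_integral (d powr p / p)) {0..d}"
    using has_integral_powr_from_0[of "p - 1" d] p d by (simp add: algebra_simps)
  ultimately have "((\<lambda>r. p * (p - 1) * d * r powr (p - 2) - p * (p - 1) * r powr (p - 1)) has_integral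
      p * (p - 1) * d * (d powr (p - 1) / (p - 1)) - p * (p - 1) * (d powr p / p)) {0..d}"
    by (intro has_integral_diff has_integral_mult_right)
  also have "p * (p - 1) * d * (d powr (p - 1) / (p - 1)) - p * (p - 1) * (d powr p / p) =
      p * (d * d powr (p - 1)) - (p - 1) * d powr p"
    using p by simp
  also have "d * d powr (p - 1) = d powr p"
    using d powr_mult_base[of d "p - 1"] by simp
  also have "p * d powr p - (p - 1) * d powr p = d powr p"
    by (simp add: algebra_simps)
  finally have "((\<lambda>r. p * (p - 1) * r powr (p - 2) * (d - r)) has_integral d powr p) {0..d}"
  proof (rule has_integral_eq[rotated])
    fix r assume "r \<in> {0..d}"
    then have "r * r powr (p - 2) = r powr (p - 1)"
      using powr_mult_base[of r "p - 2"] by (simp add: algebra_simps)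
    then show "p * (p - 1) * d * r powr (p - 2) - p * (p - 1) * r powr (p - 1) = p * (p - 1) * r powr (p - 2) * (d - r)"
      by (simp add: algebra_simps)
  qed
  then have "(\<integral>\<^sup>+r\<in>{0..d}. ennreal (p * (p - 1) * r powr (p - 2) * (d - r)) \<partial>lborel) = ennreal (d powr p)"
    by (intro nn_integral_has_integral_lebesgue') (use p in auto)
  \<comment> \<open>The ranges differ only where the integrands vanish: beyond \<open>d\<close> the
    hinge is 0, and at 0 the weight contains \<open>0 powr (p - 2) = 0\<close>.\<close>
  moreover have "(\<integral>\<^sup>+r\<in>{0..d}. ennreal (p * (p - 1) * r powr (p - 2) * (d - r)) \<partial>lborel) =
     (\<integral>\<^sup>+r\<in>{0<..}. ennreal (p * (p - 1) * r powr (p - 2)) * ennreal (d - r) \<partial>lborel)"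
    using p by (intro nn_integral_cong)
      (auto simp: indicator_def ennreal_mult' ennreal_neg less_le)
  ultimately show ?thesis by simp
qed

text \<open>Of all couplings the comonotone one gives the least mass to each of the events
  \<open>X \<le> t - r, t < Y\<close>, over whose indicators the hinge function integrates.\<close>

lemma nn_integral_hinge_quantile_le:
  fixes X Y :: "'a \<Rightarrow> real"
  assumes "prob_space M" and [measurable]: "X \<in> borel_measurable M" "Y \<in> borel_measurable M"
  shows "(\<integral>\<^sup>+u. ennreal (quantile M Y u - quantile M X u - r) \<partial>unit_interval) \<le>
    (\<integral>\<^sup>+x. ennreal (Y x - X x - r) \<partial>M)"
proof -
  interpret prob_space M by fact
  interpret U: prob_space unit_interval by (rule prob_space_unit_interval)
  interpret P1: pair_sigma_finite M lborel ..
  interpret P2: pair_sigma_finite unit_interval lborel ..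
  note [measurable] = measurable_quantile[OF assms(1,2)] measurable_quantile[OF assms(1,3)]
  let ?F = "cdf (distr M borel X)" and ?G = "cdf (distr M borel Y)"
  \<comment> \<open>The positive part is the length of \<open>{a + r..<b}\<close>, written as an
    integral over the levels \<open>t\<close>.\<close>
  have layer: "ennreal (b - a - r) = (\<integral>\<^sup>+t. (if a \<le> t - r \<and> t < b then 1 else 0) \<partial>lborel)" for a b :: real
  proof -
    have "{t. a \<le> t - r \<and> t < b} = {a + r..<b}" by auto
    then have "ennreal (b - a - r) = (\<integral>\<^sup>+t. indicator {t. a \<le> t - r \<and> t < b} t \<partial>lborel)"
      by (cases "a + r \<le> b") (auto simp: ennreal_neg algebra_simps)
    then show ?thesis by (simp add: indicator_def of_bool_def)
  qed
  have "(\<integral>\<^sup>+u. ennreal (quantile M Y u - quantile M X u - r) \<partial>unit_interval) =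
      (\<integral>\<^sup>+t. \<integral>\<^sup>+u. (if quantile M X u \<le> t - r \<and> t < quantile M Y u then 1 else 0) \<partial>unit_interval \<partial>lborel)"
    unfolding layer by (rule P2.Fubini'[symmetric]) simp
  \<comment> \<open>For quantile functions the condition on \<open>u\<close> cuts out the interval
    \<open>{?G t <.. ?F (t - r)}\<close>.\<close>
  also have "\<dots> = (\<integral>\<^sup>+t. ennreal (?F (t - r) - ?G t) \<partial>lborel)"
  proof (rule nn_integral_cong)
    fix t
    have 1: "(0::real) \<le> ?G t" "?F (t - r) \<le> 1"
      by (simp_all add: cdf_def measure_distr)
    have "(\<integral>\<^sup>+u. (if quantile M X u \<le> t - r \<and> t < quantile M Y u then 1 else 0) \<partial>unit_interval) =
       (\<integral>\<^sup>+u. indicator {?G t <.. ?F (t - r)} u * indicator {0<..<1} u \<partial>lborel)"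
      by (subst nn_integral_restrict_space)
       (auto intro!: nn_integral_cong simp: indicator_def quantile_le_iff[OF assms(1,2)] quantile_le_iff[OF assms(1,3)]
          simp flip: not_le)
    \<comment> \<open>By \<open>1\<close> the interval lies in \<open>(0, 1]\<close>, so restriction
      to the open unit interval loses at most the point 1.\<close>
    also have "\<dots> = (\<integral>\<^sup>+u. indicator {?G t <.. ?F (t - r)} u \<partial>lborel)"
      using AE_lborel_singleton[of 1] 1
      by (intro nn_integral_cong_AE) (auto elim!: eventually_mono simp: indicator_def)
    also have "\<dots> = ennreal (?F (t - r) - ?G t)"
      by (cases "?G t \<le> ?F (t - r)") (auto simp: ennreal_neg)
    finally show "(\<integral>\<^sup>+u. (if quantile M X u \<le> t - r \<and> t < quantile M Y u then 1 else 0) \<partial>unit_interval) =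
      ennreal (?F (t - r) - ?G t)" .
  qed
  \<comment> \<open>Under any coupling the event \<open>?A - ?B\<close> has at least the difference
    of the two probabilities.\<close>
  also have "\<dots> \<le> (\<integral>\<^sup>+t. \<integral>\<^sup>+x. (if X x \<le> t - r \<and> t < Y x then 1 else 0) \<partial>M \<partial>lborel)"
  proof (rule nn_integral_mono)
    fix t
    let ?A = "{x \<in> space M. X x \<le> t - r}" and ?B = "{x \<in> space M. Y x \<le> t}"
    have "?F (t - r) - ?G t = prob ?A - prob ?B"
      by (auto simp: cdf_def measure_distr intro!: arg_cong2[where f = "\<lambda>x y. prob x - prob y"])
    also have "\<dots> \<le> prob (?A - ?B)"
      using measure_Un_le[of "?A - ?B" M ?B] finite_measure_mono[of ?A "(?A - ?B) \<union> ?B"] by auto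
    finally have "ennreal (?F (t - r) - ?G t) \<le> emeasure M (?A - ?B)"
      by (simp add: emeasure_eq_measure ennreal_leI)
    also have "\<dots> = (\<integral>\<^sup>+x. indicator (?A - ?B) x \<partial>M)" by simp
    also have "\<dots> = (\<integral>\<^sup>+x. (if X x \<le> t - r \<and> t < Y x then 1 else 0) \<partial>M)"
      by (intro nn_integral_cong) (auto simp: indicator_def)
    finally show "ennreal (?F (t - r) - ?G t) \<le> (\<integral>\<^sup>+x. (if X x \<le> t - r \<and> t < Y x then 1 else 0) \<partial>M)" .
  qed
  also have "\<dots> = (\<integral>\<^sup>+x. ennreal (Y x - X x - r) \<partial>M)"
    unfolding layer by (rule P1.Fubini') simp
  finally show ?thesis .
qed

text \<open>For \<open>p = 1\<close> this is the hinge at \<open>r = 0\<close>. For larger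
  \<open>p\<close> the weights of the mixture are nonnegative and the same for both couplings, so by
  Tonelli's theorem the comparison of hinges integrates.\<close>

lemma nn_integral_pos_part_powr_quantile_le:
  fixes X Y :: "'a \<Rightarrow> real"
  assumes "prob_space M" and [measurable]: "X \<in> borel_measurable M" "Y \<in> borel_measurable M" and p: "1 \<le> p"
  shows "(\<integral>\<^sup>+u. ennreal (max 0 (quantile M Y u - quantile M X u) powr p) \<partial>unit_interval) \<le>
    (\<integral>\<^sup>+x. ennreal (max 0 (Y x - X x) powr p) \<partial>M)"
proof (cases "p = 1")
  case True
  then have "ennreal (max 0 d powr p) = ennreal (d - 0)" for d
    by (auto simp: max_def ennreal_neg)
  then show ?thesis
    using nn_integral_hinge_quantile_le[OF assms(1-3), of 0] by simp
next
  case False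
  then have p1: "1 < p" using p by simp
  interpret prob_space M by fact
  interpret U: prob_space unit_interval by (rule prob_space_unit_interval)
  interpret P1: pair_sigma_finite M lborel ..
  interpret P2: pair_sigma_finite unit_interval lborel ..
  note [measurable] = measurable_quantile[OF assms(1,2)] measurable_quantile[OF assms(1,3)]
  define w where "w r = ennreal (p * (p - 1) * r powr (p - 2)) * indicator {0<..} r" for r
  have [measurable]: "w \<in> borel_measurable borel" unfolding w_def by measurable
  have hinge: "ennreal (max 0 d powr p) = (\<integral>\<^sup>+r. w r * ennreal (d - r) \<partial>lborel)" for d
  proof -
    have "ennreal (max 0 d powr p) = (\<integral>\<^sup>+r. w r * ennreal (max 0 d - r) \<partial>lborel)"
      unfolding nn_integral_hinge[OF _ p1, of "max 0 d", simplified, symmetric]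
      by (simp add: w_def mult_ac)
    also have "\<dots> = (\<integral>\<^sup>+r. w r * ennreal (d - r) \<partial>lborel)"
      by (intro nn_integral_cong) (auto simp: w_def max_def ennreal_neg indicator_def)
    finally show ?thesis .
  qed
  have "(\<integral>\<^sup>+u. ennreal (max 0 (quantile M Y u - quantile M X u) powr p) \<partial>unit_interval) =
      (\<integral>\<^sup>+r. \<integral>\<^sup>+u. w r * ennreal (quantile M Y u - quantile M X u - r) \<partial>unit_interval \<partial>lborel)"
    unfolding hinge by (rule P2.Fubini'[symmetric]) simp
  also have "\<dots> \<le> (\<integral>\<^sup>+r. \<integral>\<^sup>+x. w r * ennreal (Y x - X x - r) \<partial>M \<partial>lborel)"
    by (intro nn_integral_mono)
      (simp add: nn_integral_cmult mult_left_mono nn_integral_hinge_quantile_le assms)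
  also have "\<dots> = (\<integral>\<^sup>+x. ennreal (max 0 (Y x - X x) powr p) \<partial>M)"
    unfolding hinge by (rule P1.Fubini') simp
  finally show ?thesis .
qed

text \<open>At each point only one of the two positive parts is nonzero, so the power splits, and
  the one-sided bound is used twice with \<open>X\<close> and \<open>Y\<close> exchanged.\<close>

lemma nn_integral_powr_quantile_diff_le:
  fixes X Y :: "'a \<Rightarrow> real"
  assumes "prob_space M" and [measurable]: "X \<in> borel_measurable M" "Y \<in> borel_measurable M" and p: "1 \<le> p"
  shows "(\<integral>\<^sup>+u. ennreal (\<bar>quantile M X u - quantile M Y u\<bar> powr p) \<partial>unit_interval) \<le>
    (\<integral>\<^sup>+x. ennreal (\<bar>X x - Y x\<bar> powr p) \<partial>M)"
proof -
  note [measurable] = measurable_quantile[OF assms(1,2)] measurable_quantile[OF assms(1,3)]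
  have split: "ennreal (\<bar>a - b\<bar> powr p) = ennreal (max 0 (a - b) powr p) + ennreal (max 0 (b - a) powr p)" for a b :: real
    by (auto simp: max_def abs_if)
  show ?thesis
    unfolding split by (simp add: nn_integral_add add_mono nn_integral_pos_part_powr_quantile_le assms)
qed

subsection \<open>Attaining the norm bound\<close>

text \<open>Without atoms a set of positive measure splits into two such sets, the smaller of which
  has at most half the measure; this is iterated.\<close>

lemma atomless_small_subset:
  assumes "finite_measure M" and atomless: "atomless M"
    and A: "A \<in> sets M" "0 < measure M A" and \<epsilon>: "0 < \<epsilon>"
  obtains B where "B \<in> sets M" "B \<subseteq> A" "0 < measure M B" "measure M B < \<epsilon>"
proof -
  interpret finite_measure M by fact
  have halve: "\<exists>B\<in>sets M. B \<subseteq> A \<and> 0 < measure M B \<and> measure M B \<le> measure M A / 2 ^ n" for n :: nat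
  proof (induction n)
    case 0
    then show ?case using A by auto
  next
    case (Suc n)
    then obtain B where B: "B \<in> sets M" "B \<subseteq> A" "0 < measure M B" "measure M B \<le> measure M A / 2 ^ n"
      by auto
    then obtain C where C: "C \<in> sets M" "C \<subseteq> B" "0 < measure M C" "measure M C < measure M B"
      using atomless unfolding atomless_def
      by (auto simp: emeasure_eq_measure ennreal_less_iff)
    have half: "measure M B / 2 \<le> measure M A / 2 ^ Suc n"
      using B(4) by (simp add: field_simps)
    have diff: "measure M (B - C) = measure M B - measure M C"
      using B C by (intro finite_measure_Diff) auto
    show ?case
    proof (cases "measure M C \<le> measure M B / 2")
      case True
      then show ?thesis using B C half by (intro bexI[of _ C]) auto
    next
      case False
      then show ?thesis using B C diff half by (intro bexI[of _ "B - C"]) auto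
    qed
  qed
  obtain n :: nat where "measure M A / \<epsilon> < 2 ^ n"
    using real_arch_pow[of 2 "measure M A / \<epsilon>"] by auto
  then have "measure M A / 2 ^ n < \<epsilon>" using \<epsilon> by (simp add: field_simps)
  with halve[of n] show thesis using that by force
qed

text \<open>The sets with integer bounds exhaust the space, so they cannot all be null. Density mass
  placed inside such a set has a controlled effect on the expectation of \<open>X\<close>.\<close>

lemma (in prob_space) bounded_on_positive_set:
  fixes X :: "'a \<Rightarrow> real"
  assumes [measurable]: "X \<in> borel_measurable M"
  obtains K where "0 \<le> K" "0 < prob {x \<in> space M. \<bar>X x\<bar> \<le> K}"
proof (rule ccontr)
  assume "\<not> thesis"
  then have "prob {x \<in> space M. \<bar>X x\<bar> \<le> real n} \<le> 0" for n
    using that[of "real n"] by force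
  then have "{x \<in> space M. \<bar>X x\<bar> \<le> real n} \<in> null_sets M" for n
    by (auto simp: null_sets_def emeasure_eq_measure measure_le_0_iff)
  then have "(\<Union>n. {x \<in> space M. \<bar>X x\<bar> \<le> real n}) \<in> null_sets M"
    by auto
  also have "(\<Union>n. {x \<in> space M. \<bar>X x\<bar> \<le> real n}) = space M"
    using real_arch_simple by auto
  finally show False using prob_space by (auto simp: null_sets_def emeasure_space_1)
qed

lemma add_powr_le:
  fixes a b p :: real
  assumes "0 \<le> a" "0 \<le> b" "0 \<le> p"
  shows "(a + b) powr p \<le> 2 powr p * (a powr p + b powr p)"
proof -
  have "(a + b) powr p \<le> (2 * max a b) powr p" using assms by (intro powr_mono2) auto
  also have "\<dots> = 2 powr p * max a b powr p" using assms by (simp add: powr_mult)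
  also have "\<dots> \<le> 2 powr p * (a powr p + b powr p)" by (intro mult_left_mono) (auto simp: max_def)
  finally show ?thesis .
qed

lemma Lp_add:
  assumes "f \<in> Lp M p" "g \<in> Lp M p" "0 \<le> p"
  shows "(\<lambda>x. f x + g x) \<in> Lp M p"
proof -
  have [measurable]: "f \<in> borel_measurable M" "g \<in> borel_measurable M" using assms by (auto simp: Lp_def)
  have "integrable M (\<lambda>x. 2 powr p * (\<bar>f x\<bar> powr p + \<bar>g x\<bar> powr p))"
    using assms by (auto simp: Lp_def)
  then have "integrable M (\<lambda>x. \<bar>f x + g x\<bar> powr p)"
  proof (rule Bochner_Integration.integrable_bound, goal_cases)
    case 2
    have "\<bar>f x + g x\<bar> powr p \<le> 2 powr p * (\<bar>f x\<bar> powr p + \<bar>g x\<bar> powr p)" for x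
      using powr_mono2[of p "\<bar>f x + g x\<bar>" "\<bar>f x\<bar> + \<bar>g x\<bar>"] add_powr_le[of "\<bar>f x\<bar>" "\<bar>g x\<bar>" p] assms(3)
      by linarith
    then show ?case by auto
  qed auto
  then show ?thesis by (simp add: Lp_def)
qed

lemma Lp_cmult: "f \<in> Lp M p \<Longrightarrow> (\<lambda>x. a * f x) \<in> Lp M p"
  by (auto simp: Lp_def abs_mult powr_mult)

lemma dual_ball_integral:
  assumes "Z \<in> dual_ball M p c"
  shows "integrable M Z" "(\<integral>x. Z x \<partial>M) = 1"
proof -
  have Z: "Z \<in> borel_measurable M" "\<And>x. 0 \<le> Z x" "(\<integral>\<^sup>+x. ennreal (Z x) \<partial>M) = ennreal 1"
    using assms by (auto simp: dual_ball_def)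
  then show "integrable M Z" by (intro integrableI_nonneg) auto
  show "(\<integral>x. Z x \<partial>M) = 1" using Z by (simp add: integral_eq_nn_integral)
qed

text \<open>The new density equals \<open>c\<close> on a small set and is a multiple of \<open>Z\<close> elsewhere.\<close>

lemma dual_ball_attain_norm_1:
  fixes X Z :: "'a \<Rightarrow> real"
  assumes "prob_space M" and "atomless M" and X: "X \<in> Lp M 1" and Z: "Z \<in> dual_ball M 1 c"
    and c: "1 \<le> c" and \<epsilon>: "0 < \<epsilon>"
  obtains Z' h where "Z' \<in> dual_ball M 1 c" "h \<in> borel_measurable M" "\<And>x. 0 \<le> h x"
    and "(\<integral>\<^sup>+x. ennreal (h x powr 1) \<partial>M) \<le> 1" and "(\<integral>x. Z' x * h x \<partial>M) = c"
    and "(\<integral>x. Z x * X x \<partial>M) - \<epsilon> \<le> (\<integral>x. Z' x * X x \<partial>M)"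
proof -
  interpret prob_space M by fact
  have [measurable]: "X \<in> borel_measurable M" "Z \<in> borel_measurable M" and Znn: "\<And>x. 0 \<le> Z x"
    and Zc: "AE x in M. Z x \<le> c"
    using X Z by (auto simp: Lp_def dual_ball_def)
  have Xi: "integrable M X" using X by (simp add: Lp_def integrable_abs_iff)
  note Zi = dual_ball_integral[OF Z]
  have ZXi: "integrable M (\<lambda>x. Z x * X x)"
    using integrable_dual_ball_mult[OF Z X] c by simp
  define T where "T = (\<integral>x. Z x * X x \<partial>M)"
  obtain K where K: "0 \<le> K" "0 < prob {x \<in> space M. \<bar>X x\<bar> \<le> K}"
    using bounded_on_positive_set[of X] by auto
  \<comment> \<open>The first bound gives \<open>c * prob B \<le> 1 / 2\<close>, which keeps
    \<open>1 - e\<close> away from 0; the second keeps the loss in expectation below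
    \<open>\<epsilon>\<close>.\<close>
  define b0 where "b0 = min (1 / (2 * c)) (\<epsilon> / (2 * c * (\<bar>T\<bar> + K + 1)))"
  have "0 < b0" using c K \<epsilon> by (auto simp: b0_def)
  then obtain B where B[measurable]: "B \<in> sets M" and BK: "B \<subseteq> {x \<in> space M. \<bar>X x\<bar> \<le> K}"
    and b: "0 < prob B" "prob B < b0"
    using atomless_small_subset[OF finite_measure_axioms \<open>atomless M\<close> _ K(2)] by auto
  have cb: "c * prob B \<le> 1 / 2" using b(2) c by (simp add: b0_def field_simps)
  have "prob B * (2 * c * (\<bar>T\<bar> + K + 1)) < \<epsilon>"
    using b(2) c K by (simp add: b0_def pos_less_divide_eq)
  then have b\<epsilon>: "2 * (c * prob B) * (\<bar>T\<bar> + K + 1) < \<epsilon>" by (simp add: algebra_simps)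
  have XB: "\<bar>indicator B x * X x\<bar> \<le> K * indicator B x" for x
    using BK by (auto simp: indicator_def)
  have Bi: "integrable M (\<lambda>x. indicator B x :: real)" using B by (simp add: emeasure_eq_measure)
  define e where "e = (\<integral>x. Z x * indicator B x \<partial>M)"
  have ei: "integrable M (\<lambda>x. Z x * indicator B x)"
    using integrable_real_mult_indicator[OF B Zi(1)] by simp
  have e: "0 \<le> e" "e \<le> c * prob B"
  proof -
    show "0 \<le> e" unfolding e_def using Znn by (intro integral_nonneg_AE) auto
    have "e \<le> (\<integral>x. c * indicator B x \<partial>M)"
      unfolding e_def
    proof (rule integral_mono_AE)
      show "AE x in M. Z x * indicator B x \<le> c * indicator B x"
        using Zc by eventually_elim (simp add: mult_right_mono)
    qed (use ei Bi in auto)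
    then show "e \<le> c * prob B" by simp
  qed
  \<comment> \<open>The factor off \<open>B\<close> that restores total mass 1. As
    \<open>e \<le> c * prob B\<close>, it is at most 1, so the bound \<open>c\<close> survives
    there.\<close>
  define s where "s = (1 - c * prob B) / (1 - e)"
  have s: "0 \<le> s" "s \<le> 1" "s * (1 - e) = 1 - c * prob B" "1 - s \<le> 2 * (c * prob B)"
  proof -
    show "0 \<le> s" "s \<le> 1" "s * (1 - e) = 1 - c * prob B"
      using e cb by (auto simp: s_def)
    have "(1 - s) * (1 - e) \<le> 2 * (c * prob B) * (1 - e)"
    proof -
      have "(1 - s) * (1 - e) = c * prob B - e" using \<open>s * (1 - e) = _\<close> by (simp add: algebra_simps)
      also have "\<dots> \<le> 2 * (c * prob B) * (1 / 2)" using e by simp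
      also have "\<dots> \<le> 2 * (c * prob B) * (1 - e)" using e cb by (intro mult_left_mono) auto
      finally show ?thesis .
    qed
    then show "1 - s \<le> 2 * (c * prob B)" using e cb by (auto simp: mult_le_cancel_right)
  qed
  define Z' where "Z' x = c * indicator B x + s * (Z x - Z x * indicator B x)" for x
  \<comment> \<open>Norm one and supported on \<open>B\<close>, where \<open>Z'\<close> equals
    \<open>c\<close>; hence the pairing with \<open>Z'\<close> is \<open>c\<close>.\<close>
  define h :: "'a \<Rightarrow> real" where "h x = indicator B x / prob B" for x
  have [measurable]: "Z' \<in> borel_measurable M" "h \<in> borel_measurable M"
    unfolding Z'_def h_def by measurable
  have Z'nn: "0 \<le> Z' x" for x using s c Znn by (auto simp: Z'_def indicator_def)
  have Z'i: "integrable M Z'" unfolding Z'_def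
    by (intro Bochner_Integration.integrable_add Bochner_Integration.integrable_diff integrable_mult_right Bi Zi ei)
  have "(\<integral>x. Z' x \<partial>M) = c * prob B + s * (1 - e)"
    unfolding Z'_def using Zi ei Bi B by (simp add: e_def)
  then have "(\<integral>\<^sup>+x. ennreal (Z' x) \<partial>M) = 1"
    using s Z'i Z'nn by (subst nn_integral_eq_integral) auto
  moreover have "AE x in M. Z' x \<le> c"
    using Zc
  proof eventually_elim
    case (elim x)
    have "s * Z x \<le> 1 * Z x" using s Znn by (intro mult_right_mono) auto
    with elim show ?case by (auto simp: Z'_def indicator_def)
  qed
  ultimately have "Z' \<in> dual_ball M 1 c" using Z'nn by (simp add: dual_ball_def)
  moreover have "(\<integral>\<^sup>+x. ennreal (h x powr 1) \<partial>M) \<le> 1"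
  proof -
    have "(\<integral>\<^sup>+x. ennreal (h x powr 1) \<partial>M) = (\<integral>\<^sup>+x. ennreal (1 / prob B) * indicator B x \<partial>M)"
      using b by (intro nn_integral_cong) (auto simp: h_def indicator_def)
    also have "\<dots> = ennreal (1 / prob B * prob B)"
      using b by (simp add: nn_integral_cmult_indicator emeasure_eq_measure flip: ennreal_mult)
    finally show ?thesis using b by simp
  qed
  moreover have "(\<integral>x. Z' x * h x \<partial>M) = c"
  proof -
    have "(\<integral>x. Z' x * h x \<partial>M) = (\<integral>x. c / prob B * indicator B x \<partial>M)"
      by (intro Bochner_Integration.integral_cong) (auto simp: Z'_def h_def indicator_def)
    then show ?thesis using b by simp
  qed
  moreover have "T - \<epsilon> \<le> (\<integral>x. Z' x * X x \<partial>M)"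
  proof -
    define J where "J = (\<integral>x. Z x * (indicator B x * X x) \<partial>M)"
    define L where "L = (\<integral>x. indicator B x * X x \<partial>M)"
    have Li: "integrable M (\<lambda>x. indicator B x * X x)" 
      using integrable_real_mult_indicator[OF B Xi] by (simp add: mult.commute)
    have Ji: "integrable M (\<lambda>x. Z x * (indicator B x * X x))"
      using integrable_real_mult_indicator[OF B ZXi] by (simp add: mult_ac)
    have "\<bar>L\<bar> \<le> (\<integral>x. K * indicator B x \<partial>M)"
      unfolding L_def by (rule integral_abs_bound[THEN order_trans], rule integral_mono)
        (use Li XB Bi in auto)
    then have L: "c * \<bar>L\<bar> \<le> K * (c * prob B)" using c by (simp add: mult_left_mono algebra_simps)
    have "\<bar>J\<bar> \<le> (\<integral>x. K * (Z x * indicator B x) \<partial>M)"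
      unfolding J_def
    proof (rule integral_abs_bound[THEN order_trans], rule integral_mono)
      show "\<bar>Z x * (indicator B x * X x)\<bar> \<le> K * (Z x * indicator B x)" for x
        using mult_left_mono[OF XB Znn[of x], of x] Znn[of x] by (simp add: abs_mult mult_ac)
    qed (use Ji ei in auto)
    also have "\<dots> \<le> K * (c * prob B)" using e K by (simp add: e_def[symmetric] mult_left_mono)
    finally have J: "\<bar>J\<bar> \<le> K * (c * prob B)" .
    have "(\<integral>x. Z' x * X x \<partial>M) = (\<integral>x. c * (indicator B x * X x) + s * (Z x * X x - Z x * (indicator B x * X x)) \<partial>M)"
      by (intro Bochner_Integration.integral_cong) (auto simp: Z'_def algebra_simps)
    also have "\<dots> = c * L + s * (T - J)"
      using Li Ji ZXi by (simp add: L_def J_def T_def)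
    finally have eq: "(\<integral>x. Z' x * X x \<partial>M) = c * L + s * (T - J)" .
    \<comment> \<open>The loss is \<open>(1 - s) * T + s * J - c * L\<close>, and each term is at
      most a constant times \<open>c * prob B\<close>.\<close>
    have "(1 - s) * T \<le> 2 * (c * prob B) * \<bar>T\<bar>"
      using mult_left_mono[of T "\<bar>T\<bar>" "1 - s"] mult_right_mono[OF s(4), of "\<bar>T\<bar>"] s(2) by linarith
    moreover have "s * J \<le> \<bar>J\<bar>" 
      using s mult_left_mono[of J "\<bar>J\<bar>" s] mult_right_mono[of s 1 "\<bar>J\<bar>"] by linarith
    moreover have "- (c * L) \<le> c * \<bar>L\<bar>" using c mult_left_mono[of "- L" "\<bar>L\<bar>" c] by simp
    ultimately have "T - (c * L + s * (T - J)) \<le> 2 * (c * prob B) * \<bar>T\<bar> + K * (c * prob B) + K * (c * prob B)"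
      using J L by (simp add: algebra_simps)
    also have "\<dots> \<le> 2 * (c * prob B) * (\<bar>T\<bar> + K + 1)" using c by (simp add: algebra_simps)
    finally show ?thesis using b\<epsilon> eq by simp
  qed
  ultimately show thesis
    using that[of Z' h] by (auto simp: h_def T_def)
qed

text \<open>Mixing in a little of a highly concentrated density makes the norm exceed \<open>c\<close>; the intermediate
  value theorem then gives a mixture of norm exactly \<open>c\<close>.\<close>

lemma dual_ball_attain_norm_gt_1:
  fixes X Z :: "'a \<Rightarrow> real"
  assumes "prob_space M" and "atomless M" and X: "X \<in> Lp M p" and Z: "Z \<in> dual_ball M p c"
    and p: "1 < p" and c: "0 < c" and \<epsilon>: "0 < \<epsilon>"
  obtains Z' h where "Z' \<in> dual_ball M p c" "h \<in> borel_measurable M" "\<And>x. 0 \<le> h x"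
    and "(\<integral>\<^sup>+x. ennreal (h x powr p) \<partial>M) \<le> 1" and "(\<integral>x. Z' x * h x \<partial>M) = c"
    and "(\<integral>x. Z x * X x \<partial>M) - \<epsilon> \<le> (\<integral>x. Z' x * X x \<partial>M)"
proof -
  interpret prob_space M by fact
  define q where "q = p / (p - 1)"
  have q: "1 < q" "(q - 1) * p = q" using p by (auto simp: q_def field_simps)
  have [measurable]: "X \<in> borel_measurable M" "Z \<in> borel_measurable M" and Znn: "\<And>x. 0 \<le> Z x"
    and Zq: "(\<integral>\<^sup>+x. ennreal (Z x powr q) \<partial>M) \<le> ennreal (c powr q)"
    using X Z p by (auto simp: Lp_def dual_ball_def q_def)
  note Zi = dual_ball_integral[OF Z]
  have ZXi: "integrable M (\<lambda>x. Z x * X x)"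
    using integrable_dual_ball_mult[OF Z X] c p by simp
  have Zqi: "integrable M (\<lambda>x. Z x powr q)"
    using Zq by (intro integrableI_nonneg) (auto intro: le_less_trans)
  have Zqc: "(\<integral>x. Z x powr q \<partial>M) \<le> c powr q"
    using Zq by (subst (asm) nn_integral_eq_integral[OF Zqi]) (auto simp: integral_nonneg_AE)
  define T where "T = (\<integral>x. Z x * X x \<partial>M)"
  obtain K where K: "0 \<le> K" "0 < prob {x \<in> space M. \<bar>X x\<bar> \<le> K}"
    using bounded_on_positive_set[of X] by auto
  \<comment> \<open>Mixing with weight \<open>t\<close> moves the expectation of \<open>X\<close> by
    \<open>t * (T - L)\<close> with \<open>\<bar>L\<bar> \<le> K\<close>, so weights up to
    \<open>t0\<close> cost at most \<open>\<epsilon>\<close>.\<close>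
  define t0 where "t0 = min 1 (\<epsilon> / (\<bar>T\<bar> + K + 1))"
  have t0: "0 < t0" "t0 \<le> 1" using \<epsilon> K by (auto simp: t0_def)
  have "t0 \<le> \<epsilon> / (\<bar>T\<bar> + K + 1)" by (simp add: t0_def)
  then have "t0 * (\<bar>T\<bar> + K + 1) \<le> \<epsilon>" using K by (simp add: pos_le_divide_eq)
  \<comment> \<open>Solves \<open>t0 powr q / b0 powr (q - 1) = c powr q\<close>: on a set smaller
    than \<open>b0\<close>, already \<open>t0 * D\<close> has norm at least
    \<open>c\<close>.\<close>
  define b0 where "b0 = ((t0 / c) powr q) powr (1 / (q - 1))"
  have "0 < b0" using t0 c by (auto simp: b0_def)
  then obtain B where B[measurable]: "B \<in> sets M" and BK: "B \<subseteq> {x \<in> space M. \<bar>X x\<bar> \<le> K}"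
    and b: "0 < prob B" "prob B < b0"
    using atomless_small_subset[OF finite_measure_axioms \<open>atomless M\<close> _ K(2)] by auto
  define D :: "'a \<Rightarrow> real" where "D x = indicator B x / prob B" for x
  have [measurable]: "D \<in> borel_measurable M" unfolding D_def by measurable
  have Dnn: "0 \<le> D x" for x by (simp add: D_def)
  have Di: "integrable M D" "(\<integral>x. D x \<partial>M) = 1" using b B by (auto simp: D_def[abs_def] emeasure_eq_measure)
  have Dq: "D x powr q = (1 / prob B) powr q * indicator B x" for x by (simp add: D_def indicator_def)
  have Dqi: "integrable M (\<lambda>x. D x powr q)" unfolding Dq using B by (simp add: emeasure_eq_measure)
  have "c powr q \<le> (\<integral>x. (t0 * D x) powr q \<partial>M)"
  proof -
    have "prob B powr (q - 1) \<le> b0 powr (q - 1)" using b q by (intro powr_mono2) auto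
    also have "\<dots> = t0 powr q / c powr q" unfolding b0_def powr_powr using q t0 c by (simp add: powr_divide)
    finally have "c powr q \<le> t0 powr q / prob B powr (q - 1)" using b c by (simp add: field_simps)
    also have "\<dots> = t0 powr q * (1 / prob B) powr q * prob B"
      using b by (simp add: powr_diff powr_divide field_simps)
    also have "\<dots> = (\<integral>x. (t0 * D x) powr q \<partial>M)"
      using t0 Dnn by (simp add: powr_mult Dq)
    finally show ?thesis .
  qed
  define mix where "mix t x = (1 - t) * Z x + t * D x" for t x
  define f where "f t = (\<integral>x. mix t x powr q \<partial>M)" for t
  have [measurable]: "mix t \<in> borel_measurable M" for t unfolding mix_def by measurable
  have mix_nn: "0 \<le> mix t x" if "t \<in> {0..t0}" for t x
    using that t0 Znn Dnn by (auto simp: mix_def)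
  \<comment> \<open>A majorant independent of \<open>t\<close>, so that dominated convergence gives
    continuity of \<open>f\<close>.\<close>
  define w where "w x = 2 powr q * (Z x powr q + D x powr q)" for x
  have wi: "integrable M w" unfolding w_def using Zqi Dqi by auto
  have mix_w: "mix t x powr q \<le> w x" if "t \<in> {0..t0}" for t x
  proof -
    have "mix t x \<le> Z x + D x" unfolding mix_def
      using that t0 Znn[of x] Dnn[of x] by (intro add_mono mult_left_le_one_le) auto
    then have "mix t x powr q \<le> (Z x + D x) powr q" using mix_nn[OF that] q by (intro powr_mono2) auto
    also have "\<dots> \<le> w x" unfolding w_def using q by (intro add_powr_le Znn Dnn) auto
    finally show ?thesis .
  qed
  have mixi: "integrable M (\<lambda>x. mix t x powr q)" if "t \<in> {0..t0}" for t
    by (rule Bochner_Integration.integrable_bound[OF wi]) (use mix_w[OF that] in \<open>auto intro: order_trans[OF _ abs_ge_self]\<close>)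
  have "continuous_on {0..t0} f"
  proof (rule continuous_on_sequentiallyI)
    fix u :: "nat \<Rightarrow> real" and a assume u: "\<forall>n. u n \<in> {0..t0}" "a \<in> {0..t0}" "u \<longlonglongrightarrow> a"
    show "(\<lambda>n. f (u n)) \<longlonglongrightarrow> f a"
      unfolding f_def
    proof (rule integral_dominated_convergence[where w = w])
      show "AE x in M. (\<lambda>n. mix (u n) x powr q) \<longlonglongrightarrow> mix a x powr q"
      proof (rule AE_I2)
        fix x
        have "(\<lambda>n. mix (u n) x) \<longlonglongrightarrow> mix a x" unfolding mix_def using u(3) by (intro tendsto_intros)
        then show "(\<lambda>n. mix (u n) x powr q) \<longlonglongrightarrow> mix a x powr q"
          using u mix_nn q by (intro tendsto_powr2) auto
      qed
    qed (use wi mix_w u in auto)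
  qed
  moreover have "f 0 \<le> c powr q" using Zqc by (simp add: f_def mix_def)
  moreover have "c powr q \<le> f t0"
  proof -
    have "(\<integral>x. (t0 * D x) powr q \<partial>M) \<le> f t0" unfolding f_def
    proof (rule integral_mono)
      show "integrable M (\<lambda>x. (t0 * D x) powr q)" using Dqi by (simp add: powr_mult)
      show "(t0 * D x) powr q \<le> mix t0 x powr q" for x
        using t0 Znn Dnn q by (intro powr_mono2) (auto simp: mix_def)
    qed (use mixi t0 in auto)
    with \<open>c powr q \<le> (\<integral>x. (t0 * D x) powr q \<partial>M)\<close> show ?thesis by simp
  qed
  ultimately obtain t where t: "0 \<le> t" "t \<le> t0" "f t = c powr q"
    using IVT'[of f 0 "c powr q" t0] t0 by auto
  then have t_in: "t \<in> {0..t0}" by simp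
  \<comment> \<open>The equality case of Hoelder's inequality: the power \<open>q - 1\<close> of the
    density, normalised by its norm \<open>c\<close>.\<close>
  define h where "h x = (mix t x / c) powr (q - 1)" for x
  have [measurable]: "h \<in> borel_measurable M" unfolding h_def by measurable
  have Zt: "mix t \<in> dual_ball M p c"
  proof -
    have "integrable M (mix t)" "(\<integral>x. mix t x \<partial>M) = 1"
      using Zi Di by (auto simp: mix_def[abs_def])
    then have "(\<integral>\<^sup>+x. ennreal (mix t x) \<partial>M) = 1"
      using mix_nn[OF t_in] by (subst nn_integral_eq_integral) auto
    moreover have "(\<integral>\<^sup>+x. ennreal (mix t x powr q) \<partial>M) = ennreal (c powr q)"
      using mixi[OF t_in] t(3) by (subst nn_integral_eq_integral) (auto simp: f_def)
    ultimately show ?thesis using mix_nn[OF t_in] p by (simp add: dual_ball_def q_def)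
  qed
  have hp: "h x powr p = mix t x powr q / c powr q" for x
    unfolding h_def powr_powr q(2) using mix_nn[OF t_in] c by (simp add: powr_divide)
  have "(\<integral>\<^sup>+x. ennreal (h x powr p) \<partial>M) = ennreal (f t / c powr q)"
    unfolding hp f_def using mixi[OF t_in]
    by (subst nn_integral_eq_integral) (auto simp: integral_nonneg_AE)
  then have hp1: "(\<integral>\<^sup>+x. ennreal (h x powr p) \<partial>M) \<le> 1" using t c by simp
  have "(\<integral>x. mix t x * h x \<partial>M) = (\<integral>x. c * (mix t x powr q / c powr q) \<partial>M)"
  proof (intro Bochner_Integration.integral_cong refl)
    fix x
    have "mix t x * h x = c * ((mix t x / c) * (mix t x / c) powr (q - 1))" using c by (simp add: h_def)
    also have "\<dots> = c * (mix t x / c) powr q"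
      using mix_nn[OF t_in, of x] c by (subst powr_mult_base) auto
    finally show "mix t x * h x = c * (mix t x powr q / c powr q)"
      using mix_nn[OF t_in, of x] c by (simp add: powr_divide)
  qed
  also have "\<dots> = c * (f t / c powr q)" unfolding f_def by simp
  finally have hc: "(\<integral>x. mix t x * h x \<partial>M) = c" using t c by simp
  have "T - \<epsilon> \<le> (\<integral>x. mix t x * X x \<partial>M)"
  proof -
    define L where "L = (\<integral>x. D x * X x \<partial>M)"
    have DX: "\<bar>D x * X x\<bar> \<le> K * D x" for x
      using BK b by (auto simp: D_def indicator_def abs_mult divide_right_mono)
    have Li: "integrable M (\<lambda>x. D x * X x)"
      by (rule Bochner_Integration.integrable_bound[of _ "\<lambda>x. K * D x"])
        (use Di DX in \<open>auto intro: order_trans[OF _ abs_ge_self]\<close>)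
    have "\<bar>L\<bar> \<le> (\<integral>x. K * D x \<partial>M)"
      unfolding L_def by (rule integral_abs_bound[THEN order_trans], rule integral_mono)
        (use Li Di DX in auto)
    then have L: "\<bar>L\<bar> \<le> K" using Di by simp
    have "(\<integral>x. mix t x * X x \<partial>M) = (\<integral>x. (1 - t) * (Z x * X x) + t * (D x * X x) \<partial>M)"
      by (intro Bochner_Integration.integral_cong) (auto simp: mix_def algebra_simps)
    also have "\<dots> = (1 - t) * T + t * L" using ZXi Li by (simp add: T_def L_def)
    finally have eq: "(\<integral>x. mix t x * X x \<partial>M) = T - t * (T - L)" by (simp add: algebra_simps)
    have "t * (T - L) \<le> t * (\<bar>T\<bar> + K + 1)" using t L by (intro mult_left_mono) auto
    also have "\<dots> \<le> t0 * (\<bar>T\<bar> + K + 1)" using t K by (intro mult_right_mono) auto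
    also have "\<dots> \<le> \<epsilon>" by fact
    finally show ?thesis using eq by simp
  qed
  with Zt hp1 hc show thesis by (intro that[of "mix t" h]) (auto simp: h_def T_def)
qed

lemma dual_ball_attain_norm:
  fixes X Z :: "'a \<Rightarrow> real"
  assumes "prob_space M" and "atomless M" and "X \<in> Lp M p" and "Z \<in> dual_ball M p c"
    and "1 \<le> p" and "1 \<le> c" and "0 < \<epsilon>"
  obtains Z' h where "Z' \<in> dual_ball M p c" "h \<in> borel_measurable M" "\<And>x. 0 \<le> h x"
    and "(\<integral>\<^sup>+x. ennreal (h x powr p) \<partial>M) \<le> 1" and "(\<integral>x. Z' x * h x \<partial>M) = c"
    and "(\<integral>x. Z x * X x \<partial>M) - \<epsilon> \<le> (\<integral>x. Z' x * X x \<partial>M)"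
proof (cases "p = 1")
  case True
  with assms show thesis using dual_ball_attain_norm_1[of M X Z c \<epsilon>] that by auto
next
  case False
  with assms show thesis using dual_ball_attain_norm_gt_1[of M X p Z c \<epsilon>] that by auto
qed

subsection \<open>Worst-case risk over a Wasserstein ball\<close>

text \<open>Each side is the mean of its image law. With \<open>dual_ball_transfer\<close>, this
  carries pairings from one space to another.\<close>

lemma integral_eq_of_distr_density_eq:
  fixes X1 :: "'a \<Rightarrow> real" and X2 :: "'b \<Rightarrow> real"
  assumes [measurable]: "X1 \<in> borel_measurable N1" "X2 \<in> borel_measurable N2"
    and Z: "Z \<in> dual_ball N1 p c" "Z' \<in> dual_ball N2 p c"
    and eq: "distr (density N2 Z') borel X2 = distr (density N1 Z) borel X1"
  shows "(\<integral>x. Z' x * X2 x \<partial>N2) = (\<integral>x. Z x * X1 x \<partial>N1)"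
proof -
  have [measurable]: "Z \<in> borel_measurable N1" "Z' \<in> borel_measurable N2"
    using Z by (auto simp: dual_ball_def)
  have "(\<integral>x. x \<partial>distr (density N2 Z') borel X2) = (\<integral>x. x \<partial>distr (density N1 Z) borel X1)"
    by (simp add: eq)
  then show ?thesis
    using Z by (simp add: integral_distr integral_real_density dual_ball_def)
qed

text \<open>A density \<open>Z\<close> paired with \<open>Y\<close> is moved to a density
  \<open>V\<close> paired with the quantile function of \<open>Y\<close>. There \<open>Y\<close> is
  exchanged for \<open>X\<close> at the cost of one Hoelder estimate, and \<open>V\<close> is moved
  back to some \<open>Z'\<close> paired with \<open>X\<close>.\<close>

lemma EVaR_le_of_wasserstein_le:
  fixes X Y :: "'a \<Rightarrow> real"
  assumes M: "prob_space M" and X: "X \<in> Lp M p" and Y: "Y \<in> Lp M p" and p: "1 \<le> p"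
    and \<delta>: "0 \<le> \<delta>" and W: "wasserstein M p X Y \<le> ennreal \<delta>" and \<alpha>: "0 \<le> \<alpha>" "\<alpha> < 1"
  shows "EVaR M p \<alpha> Y \<le> EVaR M p \<alpha> X + ereal (\<delta> * (1 - \<alpha>) powr (- 1 / p))"
proof -
  define c where "c = (1 - \<alpha>) powr (- 1 / p)"
  have c: "0 \<le> c" by (simp add: c_def)
  have [measurable]: "X \<in> borel_measurable M" "Y \<in> borel_measurable M" using X Y by (auto simp: Lp_def)
  note U = prob_space_unit_interval
  note [measurable] = measurable_quantile[OF M, of X] measurable_quantile[OF M, of Y]
  have "ereal (\<integral>x. Z x * Y x \<partial>M) \<le> EVaR M p \<alpha> X + ereal (\<delta> * c)" if Z: "Z \<in> dual_ball M p c" for Z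
  proof -
    obtain V where V: "V \<in> dual_ball unit_interval p c"
      and VY: "distr (density unit_interval V) borel (quantile M Y) = distr (density M Z) borel Y"
      using dual_ball_transfer[OF M U _ _ _ Z p c, of Y "quantile M Y"] distr_quantile[OF M, of Y] by auto
    obtain Z' where Z': "Z' \<in> dual_ball M p c"
      and Z'X: "distr (density M Z') borel X = distr (density unit_interval V) borel (quantile M X)"
      using dual_ball_transfer[OF U M _ _ _ V p c, of "quantile M X" X] distr_quantile[OF M, of X] by auto
    have Vi: "integrable unit_interval (\<lambda>u. V u * quantile M X u)" "integrable unit_interval (\<lambda>u. V u * quantile M Y u)"
      using integrable_dual_ball_mult[OF V _ p c] quantile_in_Lp[OF M] X Y by auto
    have Vnn: "0 \<le> V u" for u using V by (simp add: dual_ball_def)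
    have [measurable]: "V \<in> borel_measurable unit_interval" using V by (simp add: dual_ball_def)
    \<comment> \<open>The Wasserstein bound is the \<open>L^p\<close> bound on the difference of the
      quantile functions.\<close>
    have "(\<integral>\<^sup>+u. ennreal (V u * \<bar>quantile M X u - quantile M Y u\<bar>) \<partial>unit_interval) \<le> ennreal (c * \<delta>)"
      by (rule dual_ball_Holder[OF V _ p c \<delta>]) (use W p \<delta> in \<open>auto simp: wasserstein_le_iff\<close>)
    then have "(\<integral>u. V u * \<bar>quantile M X u - quantile M Y u\<bar> \<partial>unit_interval) \<le> c * \<delta>"
      using Vnn c \<delta> by (subst integral_eq_nn_integral) (auto intro!: enn2real_leI)
    moreover have "(\<integral>u. V u * quantile M Y u - V u * quantile M X u \<partial>unit_interval) \<le>
        (\<integral>u. V u * \<bar>quantile M X u - quantile M Y u\<bar> \<partial>unit_interval)"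
    proof (rule integral_mono)
      have "integrable unit_interval (\<lambda>u. \<bar>V u * quantile M X u - V u * quantile M Y u\<bar>)"
        using Vi by auto
      then show "integrable unit_interval (\<lambda>u. V u * \<bar>quantile M X u - quantile M Y u\<bar>)"
        using Vnn by (simp add: abs_mult flip: right_diff_distrib)
      show "V u * quantile M Y u - V u * quantile M X u \<le> V u * \<bar>quantile M X u - quantile M Y u\<bar>" for u
        using Vnn unfolding right_diff_distrib[symmetric] by (intro mult_left_mono) auto
    qed (use Vi in auto)
    ultimately have "(\<integral>x. Z x * Y x \<partial>M) \<le> (\<integral>x. Z' x * X x \<partial>M) + \<delta> * c"
      using integral_eq_of_distr_density_eq[OF _ _ Z V VY] integral_eq_of_distr_density_eq[OF _ _ V Z' Z'X] Vi
      by (simp add: mult.commute)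
    then have "ereal (\<integral>x. Z x * Y x \<partial>M) \<le> ereal (\<integral>x. Z' x * X x \<partial>M) + ereal (\<delta> * c)" by simp
    also have "\<dots> \<le> EVaR M p \<alpha> X + ereal (\<delta> * c)"
      using Z' p \<alpha> M by (intro add_right_mono) (auto simp: EVaR_eq_SUP_dual_ball c_def intro: SUP_upper)
    finally show ?thesis .
  qed
  then have "(SUP Z \<in> dual_ball M p c. ereal (\<integral>x. Z x * Y x \<partial>M)) \<le> EVaR M p \<alpha> X + ereal (\<delta> * c)"
    by (rule SUP_least)
  then show ?thesis
    using EVaR_eq_SUP_dual_ball[OF M, of Y p \<alpha>] p \<alpha> by (simp add: c_def)
qed

text \<open>The previous lemma is one inequality. For the other, each \<open>Z\<close> yields a
  competitor \<open>Y\<close> that realises its value up to \<open>e\<close>, the loss from making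
  the norm of \<open>Z\<close> exactly \<open>c\<close>.\<close>

lemma SUP_EVaR_wasserstein_ball:
  fixes X :: "'a \<Rightarrow> real"
  assumes M: "prob_space M" and "atomless M" and X: "X \<in> Lp M p" and p: "1 \<le> p"
    and \<delta>: "0 \<le> \<delta>" and \<alpha>: "0 \<le> \<alpha>" "\<alpha> < 1"
  shows "(SUP Y \<in> {Y \<in> Lp M p. wasserstein M p X Y \<le> ennreal \<delta>}. EVaR M p \<alpha> Y) =
    EVaR M p \<alpha> X + ereal (\<delta> * (1 - \<alpha>) powr (- 1 / p))" (is "?S = _")
proof (rule antisym)
  show "?S \<le> EVaR M p \<alpha> X + ereal (\<delta> * (1 - \<alpha>) powr (- 1 / p))"
    using EVaR_le_of_wasserstein_le[OF M X _ p \<delta> _ \<alpha>] by (auto intro: SUP_least)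
next
  define c where "c = (1 - \<alpha>) powr (- 1 / p)"
  have c: "1 \<le> c"
  proof -
    have "c = 1 / (1 - \<alpha>) powr (1 / p)" by (simp add: c_def powr_minus divide_inverse)
    moreover have "(1 - \<alpha>) powr (1 / p) \<le> 1" "0 < (1 - \<alpha>) powr (1 / p)"
      using \<alpha> p by (auto intro: powr_le1)
    ultimately show ?thesis by simp
  qed
  have [measurable]: "X \<in> borel_measurable M" using X by (auto simp: Lp_def)
  have "ereal (\<integral>x. Z x * X x \<partial>M) + ereal (\<delta> * c) \<le> ?S" if Z: "Z \<in> dual_ball M p c" for Z
  proof (rule ereal_le_epsilon2)
    fix e :: real assume e: "0 < e"
    obtain Z' h where Z': "Z' \<in> dual_ball M p c" and h[measurable]: "h \<in> borel_measurable M"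
      and hnn: "\<And>x. 0 \<le> h x"
      and h1: "(\<integral>\<^sup>+x. ennreal (h x powr p) \<partial>M) \<le> 1" and hc: "(\<integral>x. Z' x * h x \<partial>M) = c"
      and le: "(\<integral>x. Z x * X x \<partial>M) - e \<le> (\<integral>x. Z' x * X x \<partial>M)"
      by (rule dual_ball_attain_norm[OF M \<open>atomless M\<close> X Z p c e]) (rule that)
    have hL: "h \<in> Lp M p"
      using hnn h1 by (auto simp: Lp_def intro!: integrableI_nonneg intro: le_less_trans)
    \<comment> \<open>The shift has norm at most \<open>\<delta>\<close> and raises the pairing with
      \<open>Z'\<close> by exactly \<open>\<delta> * c\<close>.\<close>
    define Y where "Y x = X x + \<delta> * h x" for x
    have Y: "Y \<in> Lp M p" unfolding Y_def using X Lp_cmult[OF hL] p by (intro Lp_add) auto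
    then have [measurable]: "Y \<in> borel_measurable M" by (auto simp: Lp_def)
    have "(\<integral>\<^sup>+u. ennreal (\<bar>quantile M X u - quantile M Y u\<bar> powr p) \<partial>unit_interval) \<le>
        (\<integral>\<^sup>+x. ennreal (\<bar>X x - Y x\<bar> powr p) \<partial>M)"
      by (rule nn_integral_powr_quantile_diff_le[OF M _ _ p]) auto
    also have "\<dots> = ennreal (\<delta> powr p) * (\<integral>\<^sup>+x. ennreal (h x powr p) \<partial>M)"
      using \<delta> hnn by (simp add: Y_def powr_mult ennreal_mult abs_mult nn_integral_cmult)
    also have "\<dots> \<le> ennreal (\<delta> powr p)" using mult_left_mono[OF h1, of "ennreal (\<delta> powr p)"] by simp
    finally have "wasserstein M p X Y \<le> ennreal \<delta>" using p \<delta> by (simp add: wasserstein_le_iff)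
    then have "EVaR M p \<alpha> Y \<le> ?S" using Y by (intro SUP_upper) auto
    moreover have "ereal (\<integral>x. Z' x * Y x \<partial>M) \<le> EVaR M p \<alpha> Y"
      using Z' p \<alpha> M by (auto simp: EVaR_eq_SUP_dual_ball c_def intro: SUP_upper)
    moreover have "(\<integral>x. Z' x * Y x \<partial>M) = (\<integral>x. Z' x * X x \<partial>M) + \<delta> * c"
    proof -
      have "(\<integral>x. Z' x * Y x \<partial>M) = (\<integral>x. Z' x * X x + \<delta> * (Z' x * h x) \<partial>M)"
        by (intro Bochner_Integration.integral_cong) (auto simp: Y_def algebra_simps)
      then show ?thesis
        using integrable_dual_ball_mult[OF Z' _ p] X hL c by (simp add: hc)
    qed
    ultimately have "ereal ((\<integral>x. Z' x * X x \<partial>M) + \<delta> * c) + ereal e \<le> ?S + ereal e"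
      by (intro add_right_mono) (metis order_trans)
    moreover have "ereal (\<integral>x. Z x * X x \<partial>M) + ereal (\<delta> * c) \<le> ereal ((\<integral>x. Z' x * X x \<partial>M) + \<delta> * c) + ereal e"
      using le by simp
    ultimately show "ereal (\<integral>x. Z x * X x \<partial>M) + ereal (\<delta> * c) \<le> ?S + ereal e"
      by (rule order_trans[rotated])
  qed
  \<comment> \<open>Moving the finite term to the right leaves a bound independent of
    \<open>Z\<close>, also when the suprema are infinite.\<close>
  then have "(SUP Z \<in> dual_ball M p c. ereal (\<integral>x. Z x * X x \<partial>M)) \<le> ?S - ereal (\<delta> * c)"
    by (intro SUP_least) (simp add: ereal_le_minus)
  then have "EVaR M p \<alpha> X \<le> ?S - ereal (\<delta> * c)"
    using EVaR_eq_SUP_dual_ball[OF M, of X p \<alpha>] p \<alpha> by (simp add: c_def)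
  then show "EVaR M p \<alpha> X + ereal (\<delta> * (1 - \<alpha>) powr (- 1 / p)) \<le> ?S"
    by (simp add: ereal_le_minus c_def)
qed

theorem proposition4p3:
  fixes M :: "'a measure" and p \<delta> :: real and \<Lambda> :: "real \<Rightarrow> real" and X :: "'a \<Rightarrow> real"
  assumes "prob_space M" and "atomless M"
    and "1 \<le> p" and "0 \<le> \<delta>"
    and "antimono \<Lambda>" and "\<And>x. \<Lambda> x \<in> {0..<1}"
    and "X \<in> Lp M p"
  shows "(SUP Y \<in> {Y \<in> Lp M p. wasserstein M p X Y \<le> ennreal \<delta>}. Lambda_EVaR M p \<Lambda> Y)
       = (SUP x. min (EVaR M p (\<Lambda> x) X + ereal (\<delta> * (1 - \<Lambda> x) powr (- 1 / p))) (ereal x))"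
proof -
  let ?B = "{Y \<in> Lp M p. wasserstein M p X Y \<le> ennreal \<delta>}"
  have "(SUP Y \<in> ?B. Lambda_EVaR M p \<Lambda> Y) = (SUP x. SUP Y \<in> ?B. min (EVaR M p (\<Lambda> x) Y) (ereal x))"
    unfolding Lambda_EVaR_def by (rule SUP_commute)
  \<comment> \<open>For fixed \<open>x\<close> the cap \<open>ereal x\<close> is constant in
    \<open>Y\<close>, and in the extended reals a minimum with a constant commutes with any
    supremum.\<close>
  also have "\<dots> = (SUP x. min (SUP Y \<in> ?B. EVaR M p (\<Lambda> x) Y) (ereal x))"
    unfolding inf_min[symmetric] SUP_inf ..
  also have "\<dots> = (SUP x. min (EVaR M p (\<Lambda> x) X + ereal (\<delta> * (1 - \<Lambda> x) powr (- 1 / p))) (ereal x))"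
    using assms(6) by (subst SUP_EVaR_wasserstein_ball[OF assms(1,2,7,3,4)]) auto
  finally show ?thesis .
qed

end
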